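(* Let $k\in\{1,2\}$, let $\phi_{H,h}^{n+1}\in S_h^{n+1}$ be the phase-energy Ritz history defined in the context, let the carrier $\boldsymbol u_{c,h}^{n+1}$ satisfy $$\langle\boldsymbol u_{c,h}^{n+1},\nabla\chi_h\rangle_\times=0\qquad\forall\chi_h\in S_h^{n+1}$$ (this includes the current-space correction used at topology-changing steps and the fixed-topology reference correction followed by the Piola map, both recalled in the context), let $\phi_h^{n+1},\mu_h^{n+1}\in S_h^{n+1}$ satisfy the discrete phase equation $$\Bigl(\frac{\gamma_k}\tau(\phi_h^{n+1}-\phi_{H,h}^{n+1}),\omega_h\Bigr)_{n+1}-\langle\phi_E^{n+1}\boldsymbol u_{c,h}^{n+1},\nabla\omega_h\rangle_\times+\frac1{Pe}\langle m_E^{n+1}\nabla\mu_h^{n+1},\nabla\omega_h\rangle_\times=0\qquad\forall\omega_h\in S_h^{n+1},$$ and define $$\boldsymbol J_{\rho,h}^{n+1}=\rho_E^{n+1}\boldsymbol u_{c,h}^{n+1}-\frac{\rho_\phi}{Pe}m_E^{n+1}\nabla\mu_h^{n+1},\qquad\rho_E^{n+1}=\rho_0+\rho_\phi\phi_E^{n+1}.$$ Then $$\Bigl(\frac{\gamma_k}\tau(\phi_h^{n+1}-\phi_{H,h}^{n+1}),1\Bigr)_{n+1}=0,$$ and, with the BE start-up (first step with $k=1$), $(\phi_h^{n+1},1)_{n+1}=(\phi_h^n,1)_n$ at every accepted time level. With $\rho_h^\ell=\rho_0+\rho_\phi\phi_h^\ell$, the total discrete density is conserved as well: $$(\rho_h^{n+1},1)_{n+1}=(\rho_h^n,1)_n.$$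 Moreover, for every $\omega_h\in S_h^{n+1}$, $$\Bigl(\frac{\gamma_k}\tau\bigl[\rho_h^{n+1}-(\rho_0+\rho_\phi\phi_{H,h}^{n+1})\bigr],\omega_h\Bigr)_{n+1}-\langle\boldsymbol J_{\rho,h}^{n+1},\nabla\omega_h\rangle_\times=0.$$
   Context: $\Omega\subset\mathbb R^d$ ($d=2,3$) is a fixed bounded polygonal or polyhedral domain. For each accepted time level $\ell$, $\mathcal T_h^\ell$ is a conforming triangulation of $\Omega$ and $S_h^\ell\subset H^1(\Omega)$, $V_h^\ell\subset[H^1(\Omega)]^d$ are conforming finite element spaces (whose functions are bounded with bounded piecewise gradients, so all integrals are finite), with $1\in S_h^\ell$; $S_{h,0}^\ell=\{v\in S_h^\ell:\int_\Omega v=0\}$. Meshes at different levels may differ (fixed-topology motion or topology-changing remeshing). $(\cdot,\cdot)_\ell$ and the cross-mesh pairing $\langle\cdot,\cdot\rangle_\times$ all denote the $L^2(\Omega)$ inner product on the fixed domain; the notation only records on which mesh(es) the arguments are represented. $\tau>0$ is the time step, $\gamma_1=1$, $\gamma_2=3/2$; $Cn,Pe,s>0$; $\rho_0,\rho_\phi$ are constants; $m(\cdot)\ge0$ is the mobility. The first time step uses $k=1$ (backward Euler, BE) and BDF2 ($k=2$) is used afterwards ($n\ge1$). For a history $z$ viewed as a function on $\Omega$: $z_H^{n+1}=z^n$, $z_E^{n+1}=z^n$ if $k=1$; $z_H^{n+1}=(4z^n-z^{n-1})/3$, $z_E^{n+1}=2z^n-z^{n-1}$ if $k=2$. Thus $\phi_H^{n+1},\phi_E^{n+1}$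 are formed from $\phi_h^n\in S_h^n,\phi_h^{n-1}\in S_h^{n-1}$, $\boldsymbol u_{E,h}^{n+1}$ from the accepted velocities $\boldsymbol u_h^n\in V_h^n,\boldsymbol u_h^{n-1}\in V_h^{n-1}$, and $m_E^{n+1}=m(\phi_E^{n+1})$. Phase-energy Ritz history: $\phi_{H,h}^{n+1}\in S_h^{n+1}$ is defined by $$Cn^2(\nabla\phi_{H,h}^{n+1},\nabla\chi_h)_{n+1}+s(\phi_{H,h}^{n+1},\chi_h)_{n+1}=Cn^2\langle\nabla\phi_H^{n+1},\nabla\chi_h\rangle_\times+s\langle\phi_H^{n+1},\chi_h\rangle_\times\quad\forall\chi_h\in S_h^{n+1}.$$ Carrier constructions. (a) Topology-changing step: find $\lambda_h^{n+1}\in S_{h,0}^{n+1}$ with $(\nabla\lambda_h^{n+1},\nabla\chi_h)_{n+1}=\langle\boldsymbol u_{E,h}^{n+1},\nabla\chi_h\rangle_\times$ for all $\chi_h\in S_{h,0}^{n+1}$, and set $\boldsymbol u_{c,h}^{n+1}=\boldsymbol u_{E,h}^{n+1}-\nabla\lambda_h^{n+1}$. (b) Fixed-topology step: there are maps $\boldsymbol X_h^\ell:\widehat\Omega\to\Omega$ from a common reference triangulation onto $\mathcal T_h^\ell$, $\boldsymbol F_h^\ell=\widehat\nabla\boldsymbol X_h^\ell$, $J_h^\ell=\det\boldsymbol F_h^\ell>0$, and a reference scalar finite element space $\widehat S_h$ containing $\chi_h\circ\boldsymbol X_h^{n+1}$ for all $\chi_h\in S_h^{n+1}$, with zero-mean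 subspace $\widehat S_{h,0}$. Pull back $\widehat{\boldsymbol u}_h^m=J_h^m(\boldsymbol F_h^m)^{-1}(\boldsymbol u_h^m\circ\boldsymbol X_h^m)$ for $m=n$ (and $m=n-1$ if $k=2$), form $\widehat{\boldsymbol u}_E^{n+1}$ by the same extrapolation, find $\widehat\lambda_h^{n+1}\in\widehat S_{h,0}$ with $(\widehat\nabla\widehat\lambda_h^{n+1},\widehat\nabla\widehat\chi_h)_{\widehat\Omega}=(\widehat{\boldsymbol u}_E^{n+1},\widehat\nabla\widehat\chi_h)_{\widehat\Omega}$ for all $\widehat\chi_h\in\widehat S_{h,0}$, and set $\boldsymbol u_{c,h}^{n+1}\circ\boldsymbol X_h^{n+1}=\frac1{J_h^{n+1}}\boldsymbol F_h^{n+1}(\widehat{\boldsymbol u}_E^{n+1}-\widehat\nabla\widehat\lambda_h^{n+1})$. *)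

theory Defs
  imports "HOL-Analysis.Analysis"
begin

text \<open>Pointwise gradient. It is used both for smooth functions and as the elementwise gradient of
  finite element functions; off the skeleton of the mesh these are continuously differentiable, so
  there it is the usual gradient (and, for functions in \<open>H1\<close>, it represents the weak gradient).
  Its unspecified values on the skeleton, a Lebesgue null set, are irrelevant.\<close>

definition grad :: "(real^'n \<Rightarrow> real) \<Rightarrow> real^'n \<Rightarrow> real^'n" where
  "grad v x = (\<chi> i. frechet_derivative v (at x) (axis i 1))"

text \<open>The same \<open>L\<^sup>2\<close> pairing serves for single-mesh and cross-mesh products, and for scalar fields
  (where the inner product is multiplication) as well as vector fields.\<close>

definition L2_inner :: "(real^'n) set \<Rightarrow> (real^'n \<Rightarrow> 'b::euclidean_space) \<Rightarrow> (real^'n \<Rightarrow> 'b) \<Rightarrow> real" where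
  "L2_inner \<Omega> f g = (LINT x:\<Omega>|lebesgue. f x \<bullet> g x)"

definition L2 :: "(real^'n) set \<Rightarrow> (real^'n \<Rightarrow> 'b::euclidean_space) set" where
  "L2 \<Omega> = {f. f \<in> borel_measurable (lebesgue_on \<Omega>) \<and> set_integrable lebesgue \<Omega> (\<lambda>x. (norm (f x))\<^sup>2)}"

primrec C_times :: "nat \<Rightarrow> (real^'n \<Rightarrow> real) \<Rightarrow> bool" where
  "C_times 0 f \<longleftrightarrow> continuous_on UNIV f"
| "C_times (Suc r) f \<longleftrightarrow> f differentiable_on UNIV \<and> (\<forall>i. C_times r (\<lambda>x. grad f x $ i))"

definition test_function :: "(real^'n) set \<Rightarrow> (real^'n \<Rightarrow> real) \<Rightarrow> bool" where
  "test_function \<Omega> f \<longleftrightarrow>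
     (\<forall>r. C_times r f) \<and> compact (closure {x. f x \<noteq> 0}) \<and> closure {x. f x \<noteq> 0} \<subseteq> \<Omega>"

definition weak_gradient :: "(real^'n) set \<Rightarrow> (real^'n \<Rightarrow> real) \<Rightarrow> (real^'n \<Rightarrow> real^'n) \<Rightarrow> bool" where
  "weak_gradient \<Omega> v g \<longleftrightarrow>
     (\<forall>f. test_function \<Omega> f \<longrightarrow>
        (\<forall>i. (LINT x:\<Omega>|lebesgue. v x * grad f x $ i) = - (LINT x:\<Omega>|lebesgue. g x $ i * f x)))"

definition H1 :: "(real^'n) set \<Rightarrow> (real^'n \<Rightarrow> real) set" where
  "H1 \<Omega> = {v \<in> L2 \<Omega>. \<exists>g \<in> L2 \<Omega>. weak_gradient \<Omega> v g}"

definition polyhedral_domain :: "(real^'n) set \<Rightarrow> bool" where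
  "polyhedral_domain \<Omega> \<longleftrightarrow>
     open \<Omega> \<and> connected \<Omega> \<and> bounded \<Omega> \<and> \<Omega> \<noteq> {} \<and>
     (\<exists>P. finite P \<and> (\<forall>p\<in>P. polytope p) \<and> frontier \<Omega> = \<Union>P)"

text \<open>A mesh consists of its closed, full-dimensional cells; the library's \<^const>\<open>triangulation\<close>
  contains the conformity condition that two cells meet in a common face.\<close>

definition conforming_triangulation :: "(real^'n) set \<Rightarrow> (real^'n) set set \<Rightarrow> bool" where
  "conforming_triangulation \<Omega> T \<longleftrightarrow>
     triangulation T \<and> (\<forall>K\<in>T. int CARD('n) simplex K) \<and> \<Union>T = closure \<Omega>"

definition fe_functions :: "(real^'n) set \<Rightarrow> (real^'n) set set \<Rightarrow> (real^'n \<Rightarrow> real) set" where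
  "fe_functions \<Omega> T =
     {v \<in> H1 \<Omega>. bounded (v ` \<Omega>) \<and>
        (\<forall>K\<in>T. v differentiable_on interior K \<and> continuous_on (interior K) (grad v) \<and>
                bounded (grad v ` interior K))}"

definition finite_dim_space :: "(real^'n \<Rightarrow> 'b::real_vector) set \<Rightarrow> bool" where
  "finite_dim_space S \<longleftrightarrow> (\<exists>B. finite B \<and> S = range (\<lambda>c x. \<Sum>b\<in>B. c b *\<^sub>R b x))"

definition fe_space :: "(real^'n) set \<Rightarrow> (real^'n) set set \<Rightarrow> (real^'n \<Rightarrow> real) set \<Rightarrow> bool" where
  "fe_space \<Omega> T S \<longleftrightarrow> finite_dim_space S \<and> S \<subseteq> fe_functions \<Omega> T"

definition vector_fe_space ::
  "(real^'n) set \<Rightarrow> (real^'n) set set \<Rightarrow> (real^'n \<Rightarrow> real^'n) set \<Rightarrow> bool" where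
  "vector_fe_space \<Omega> T V \<longleftrightarrow>
     finite_dim_space V \<and> (\<forall>v\<in>V. \<forall>i. (\<lambda>x. v x $ i) \<in> fe_functions \<Omega> T)"

definition zero_mean :: "(real^'n) set \<Rightarrow> (real^'n \<Rightarrow> real) set \<Rightarrow> (real^'n \<Rightarrow> real) set" where
  "zero_mean \<Omega> S = {v \<in> S. (LINT x:\<Omega>|lebesgue. v x) = 0}"

text \<open>The BDF order \<open>k\<close> is 1 or 2; order 2 uses the levels \<open>n\<close> and \<open>n - 1\<close>, so \<open>n \<ge> 1\<close>.\<close>

definition admissible_order :: "nat \<Rightarrow> nat \<Rightarrow> bool" where
  "admissible_order k n \<longleftrightarrow> k \<in> {1, 2} \<and> (k = 2 \<longrightarrow> 1 \<le> n)"

definition startup_order :: "nat \<Rightarrow> nat" where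
  "startup_order n = (if n = 0 then 1 else 2)"

definition bdf_gamma :: "nat \<Rightarrow> real" where
  "bdf_gamma k = (if k = 1 then 1 else 3/2)"

definition history :: "nat \<Rightarrow> nat \<Rightarrow> (nat \<Rightarrow> 'a \<Rightarrow> 'b::real_vector) \<Rightarrow> 'a \<Rightarrow> 'b" where
  "history k n z x = (if k = 1 then z n x else (1/3) *\<^sub>R (4 *\<^sub>R z n x - z (n - 1) x))"

definition extrapolation :: "nat \<Rightarrow> nat \<Rightarrow> (nat \<Rightarrow> 'a \<Rightarrow> 'b::real_vector) \<Rightarrow> 'a \<Rightarrow> 'b" where
  "extrapolation k n z x = (if k = 1 then z n x else 2 *\<^sub>R z n x - z (n - 1) x)"

definition ritz_history ::
  "(real^'n) set \<Rightarrow> real \<Rightarrow> real \<Rightarrow> (real^'n \<Rightarrow> real) set \<Rightarrow> (real^'n \<Rightarrow> real) \<Rightarrow> (real^'n \<Rightarrow> real) \<Rightarrow> bool" where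
  "ritz_history \<Omega> Cn s S z zh \<longleftrightarrow>
     zh \<in> S \<and>
     (\<forall>\<eta>\<in>S. Cn\<^sup>2 * L2_inner \<Omega> (grad zh) (grad \<eta>) + s * L2_inner \<Omega> zh \<eta>
            = Cn\<^sup>2 * L2_inner \<Omega> (grad z) (grad \<eta>) + s * L2_inner \<Omega> z \<eta>)"

definition admissible_carrier ::
  "(real^'n) set \<Rightarrow> (real^'n \<Rightarrow> real) set \<Rightarrow> (real^'n \<Rightarrow> real^'n) \<Rightarrow> bool" where
  "admissible_carrier \<Omega> S uc \<longleftrightarrow> uc \<in> L2 \<Omega> \<and> (\<forall>\<eta>\<in>S. L2_inner \<Omega> uc (grad \<eta>) = 0)"

definition topology_changing_carrier ::
  "(real^'n) set \<Rightarrow> (real^'n \<Rightarrow> real) set \<Rightarrow> (real^'n \<Rightarrow> real^'n) \<Rightarrow> (real^'n \<Rightarrow> real^'n) \<Rightarrow> bool" where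
  "topology_changing_carrier \<Omega> S uE uc \<longleftrightarrow>
     (\<exists>lam \<in> zero_mean \<Omega> S.
        (\<forall>\<eta> \<in> zero_mean \<Omega> S. L2_inner \<Omega> (grad lam) (grad \<eta>) = L2_inner \<Omega> uE (grad \<eta>)) \<and>
        (AE x in lebesgue_on \<Omega>. uc x = uE x - grad lam x))"

text \<open>A map of the reference triangulation \<open>Tr\<close> onto the mesh \<open>T\<close>: a homeomorphism carrying cells to
  cells, which on every closed cell is continuously differentiable with positive Jacobian
  determinant. On the cell interiors \<open>G\<close> is \<open>jacobian X (at y)\<close>.\<close>

definition mesh_map ::
  "(real^'n) set \<Rightarrow> (real^'n) set set \<Rightarrow> (real^'n) set \<Rightarrow> (real^'n) set set \<Rightarrow> (real^'n \<Rightarrow> real^'n) \<Rightarrow> bool" where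
  "mesh_map \<Omega>r Tr \<Omega> T X \<longleftrightarrow>
     continuous_on (closure \<Omega>r) X \<and> inj_on X (closure \<Omega>r) \<and> X ` \<Omega>r = \<Omega> \<and> (`) X ` Tr = T \<and>
     (\<forall>K\<in>Tr. \<exists>G :: real^'n \<Rightarrow> real^'n^'n. continuous_on K G \<and>
        (\<forall>y\<in>K. (X has_derivative (\<lambda>h. G y *v h)) (at y within K) \<and> 0 < det (G y)))"

definition piola_pullback ::
  "(real^'n \<Rightarrow> real^'n) \<Rightarrow> (real^'n \<Rightarrow> real^'n) \<Rightarrow> real^'n \<Rightarrow> real^'n" where
  "piola_pullback X u y =
     det (jacobian X (at y)) *\<^sub>R (matrix_inv (jacobian X (at y)) *v u (X y))"

definition fixed_topology_carrier ::
  "(real^'n) set \<Rightarrow> (nat \<Rightarrow> (real^'n) set set) \<Rightarrow> (nat \<Rightarrow> (real^'n \<Rightarrow> real) set) \<Rightarrow> nat \<Rightarrow> nat \<Rightarrow>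
   (nat \<Rightarrow> real^'n \<Rightarrow> real^'n) \<Rightarrow> (real^'n \<Rightarrow> real^'n) \<Rightarrow> bool" where
  "fixed_topology_carrier \<Omega> T S k n u uc \<longleftrightarrow>
     (\<exists>\<Omega>r Tr X Sr lam.
        polyhedral_domain \<Omega>r \<and> conforming_triangulation \<Omega>r Tr \<and>
        (\<forall>l \<in> {n, Suc n} \<union> (if k = 2 then {n - 1} else {}). mesh_map \<Omega>r Tr \<Omega> (T l) (X l)) \<and>
        fe_space \<Omega>r Tr Sr \<and>
        (\<forall>\<eta> \<in> S (Suc n). \<exists>\<eta>r \<in> Sr. \<forall>y\<in>\<Omega>r. \<eta>r y = \<eta> (X (Suc n) y)) \<and>
        lam \<in> zero_mean \<Omega>r Sr \<and>
        (\<forall>\<eta>r \<in> zero_mean \<Omega>r Sr.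
           L2_inner \<Omega>r (grad lam) (grad \<eta>r)
           = L2_inner \<Omega>r (extrapolation k n (\<lambda>l. piola_pullback (X l) (u l))) (grad \<eta>r)) \<and>
        (AE y in lebesgue_on \<Omega>r.
           uc (X (Suc n) y) =
             (1 / det (jacobian (X (Suc n)) (at y))) *\<^sub>R
             (jacobian (X (Suc n)) (at y) *v
                (extrapolation k n (\<lambda>l. piola_pullback (X l) (u l)) y - grad lam y))))"

text \<open>Arguments \<open>S \<phi>new \<phi>Hh \<phi>E mE uc \<mu>\<close>: current space, \<open>\<phi>\<^sub>h\<^sup>n\<^sup>+\<^sup>1\<close>, its Ritz history, the
  extrapolated phase and mobility, carrier and chemical potential.\<close>

definition phase_equation ::
  "(real^'n) set \<Rightarrow> real \<Rightarrow> real \<Rightarrow> nat \<Rightarrow> (real^'n \<Rightarrow> real) set \<Rightarrow> (real^'n \<Rightarrow> real) \<Rightarrow> (real^'n \<Rightarrow> real) \<Rightarrow>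
   (real^'n \<Rightarrow> real) \<Rightarrow> (real^'n \<Rightarrow> real) \<Rightarrow> (real^'n \<Rightarrow> real^'n) \<Rightarrow> (real^'n \<Rightarrow> real) \<Rightarrow> bool" where
  "phase_equation \<Omega> \<tau> Pe k S \<phi>new \<phi>Hh \<phi>E mE uc \<mu> \<longleftrightarrow>
     (\<forall>\<omega>\<in>S.
        L2_inner \<Omega> (\<lambda>x. (bdf_gamma k / \<tau>) * (\<phi>new x - \<phi>Hh x)) \<omega>
        - L2_inner \<Omega> (\<lambda>x. \<phi>E x *\<^sub>R uc x) (grad \<omega>)
        + (1 / Pe) * L2_inner \<Omega> (\<lambda>x. mE x *\<^sub>R grad \<mu> x) (grad \<omega>) = 0)"

definition scheme_step ::
  "(real^'n) set \<Rightarrow> real \<Rightarrow> real \<Rightarrow> real \<Rightarrow> real \<Rightarrow> (real \<Rightarrow> real) \<Rightarrow> (nat \<Rightarrow> (real^'n \<Rightarrow> real) set) \<Rightarrow>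
   nat \<Rightarrow> nat \<Rightarrow> (nat \<Rightarrow> real^'n \<Rightarrow> real) \<Rightarrow> (real^'n \<Rightarrow> real) \<Rightarrow> (real^'n \<Rightarrow> real) \<Rightarrow> (real^'n \<Rightarrow> real^'n) \<Rightarrow>
   bool" where
  "scheme_step \<Omega> \<tau> Cn Pe s m S k n \<phi> \<phi>Hh \<mu> uc \<longleftrightarrow>
     ritz_history \<Omega> Cn s (S (Suc n)) (history k n \<phi>) \<phi>Hh \<and>
     admissible_carrier \<Omega> (S (Suc n)) uc \<and>
     \<phi> (Suc n) \<in> S (Suc n) \<and> \<mu> \<in> S (Suc n) \<and>
     phase_equation \<Omega> \<tau> Pe k (S (Suc n)) (\<phi> (Suc n)) \<phi>Hh
       (extrapolation k n \<phi>) (\<lambda>x. m (extrapolation k n \<phi> x)) uc \<mu>"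

definition mixture_density :: "real \<Rightarrow> real \<Rightarrow> ('a \<Rightarrow> real) \<Rightarrow> 'a \<Rightarrow> real" where
  "mixture_density \<rho>0 \<rho>\<phi> f x = \<rho>0 + \<rho>\<phi> * f x"

definition mass_flux ::
  "real \<Rightarrow> real \<Rightarrow> real \<Rightarrow> (real \<Rightarrow> real) \<Rightarrow> nat \<Rightarrow> nat \<Rightarrow> (nat \<Rightarrow> real^'n \<Rightarrow> real) \<Rightarrow> (real^'n \<Rightarrow> real) \<Rightarrow>
   (real^'n \<Rightarrow> real^'n) \<Rightarrow> real^'n \<Rightarrow> real^'n" where
  "mass_flux \<rho>0 \<rho>\<phi> Pe m k n \<phi> \<mu> uc x =
     mixture_density \<rho>0 \<rho>\<phi> (extrapolation k n \<phi>) x *\<^sub>R uc x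
     - (\<rho>\<phi> / Pe * m (extrapolation k n \<phi> x)) *\<^sub>R grad \<mu> x"

end

theory Submission
  imports Defs
begin

text \<open>
  Gradients vanish on constants, so testing the phase equation and the Ritz projection with \<open>1\<close>
  yields the increment identity and turns the phase mass into the BDF recursion, which preserves a
  constant mass once the backward Euler step has provided equality at the first two levels. The
  density balance is \<open>\<rho>\<^sub>\<phi>\<close> times the phase equation plus \<open>\<rho>\<^sub>0\<close> times the
  carrier constraint.

  Both carrier corrections make a field orthogonal to gradients of zero-mean functions, hence to all
  gradients. At fixed topology this holds on the reference domain, and a change of variables on the
  union of the open cells carries it to the current mesh: the Jacobian cancels the factor in the
  Piola map, whose adjoint is the pullback of gradients. The skeletons are null sets and so
  are their images, because the mesh map is differentiable on each closed cell.
\<close>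

section \<open>Change of variables over an arbitrary finite index type\<close>

text \<open>Integrals are additive only for integrable terms, so measurability and integrability of
  every field have to be derived. Two things stand in the way: elementwise gradients have arbitrary
  values on the skeleton, and a corrected carrier is prescribed only almost everywhere, at fixed
  topology even only after composition with the mesh map. The remedy is that all fields involved are
  continuous and bounded on the open cells, hence essentially bounded. For Piola transforms this
  rests on the Jacobian extending continuously, with positive determinant, to each compact cell;
  invariance of domain supplies the inverse that turns a formula for the carrier composed with
  \<open>X\<close> into one for the carrier itself. If M(n) is the phase mass, order 2 gives M(n+1)
  - M(n) = (M(n) - M(n-1)) / 3. A nonzero first difference would decay without vanishing, and only
  the backward Euler step makes it zero. The Ritz projection keeps the mass because the zero-order
  weight \<open>s\<close> is positive.\<close>

text \<open>The change of variables theorem of the library requires the index type of \<open>real^'n\<close> to be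
  well-ordered. It is transported to any finite index type along a bijection with the following
  well-ordered type of the same cardinality.\<close>

typedef ('a::finite) index = "{..<CARD('a)}"
  morphisms of_index Index
  by (rule exI[of _ 0]) simp

instance index :: (finite) finite
proof
  have "range (of_index :: 'a index \<Rightarrow> nat) \<subseteq> {..<CARD('a)}"
    using of_index by auto
  then show "finite (UNIV :: 'a index set)"
    by (meson finite_lessThan finite_subset finite_imageD injI of_index_inject)
qed

instantiation index :: (finite) wellorder
begin

definition less_eq_index :: "'a index \<Rightarrow> 'a index \<Rightarrow> bool" where
  "x \<le> y \<longleftrightarrow> of_index x \<le> of_index y"

definition less_index :: "'a index \<Rightarrow> 'a index \<Rightarrow> bool" where
  "x < y \<longleftrightarrow> of_index x < of_index y"

instance
proof
  fix P :: "'a index \<Rightarrow> bool" and a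
  assume step: "\<And>x. (\<And>y. y < x \<Longrightarrow> P y) \<Longrightarrow> P x"
  show "P a"
    by (induction a rule: measure_induct_rule[where f = of_index])
       (auto intro: step simp: less_index_def)
qed (auto simp: less_eq_index_def less_index_def of_index_inject)

end

lemma card_index: "CARD('a::finite index) = CARD('a)"
  using type_definition.card[OF type_definition_index] by simp

text \<open>Conjugation by \<open>\<pi>\<close> is a sign-preserving bijection from the permutations
  of \<open>'m\<close> to those of \<open>'n\<close> and matches the terms of the two Leibniz sums.
  Rows and columns are relabelled by the same \<open>\<pi>\<close>, so no sign is left over.\<close>

lemma det_reindex:
  fixes A :: "real^'n^'n" and \<pi> :: "'m::finite \<Rightarrow> 'n"
  assumes "bij \<pi>"
  shows "det (\<chi> i j. A $ \<pi> i $ \<pi> j) = det A"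
proof -
  have inj: "inj \<pi>" and [simp]: "range \<pi> = UNIV"
    using assms by (auto simp: bij_def)
  have mp: "map_permutation UNIV \<pi> p (\<pi> i) = \<pi> (p i)" for p i
    using map_permutation_apply[OF inj] by simp
  have "det A = (\<Sum>p\<in>{p. p permutes (UNIV::'m set)}.
      of_int (sign (map_permutation UNIV \<pi> p)) * (\<Prod>j\<in>UNIV. A $ j $ map_permutation UNIV \<pi> p j))"
    unfolding det_def
  proof (rule sum.reindex_bij_betw[symmetric], rule bij_betw_byWitness)
    show "\<forall>p\<in>{p. p permutes UNIV}. map_permutation UNIV (inv \<pi>) (map_permutation UNIV \<pi> p) = p"
      using assms inj by (auto intro!: map_permutation_compose_inv)
    show "\<forall>p\<in>{p. p permutes UNIV}. map_permutation UNIV \<pi> (map_permutation UNIV (inv \<pi>) p) = p"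
      using bij_imp_bij_inv[OF assms] assms
      by (auto intro!: map_permutation_compose_inv simp: bij_is_surj surj_f_inv_f)
  qed (use assms bij_imp_bij_inv[OF assms] in \<open>auto intro: map_permutation_permutes\<close>)
  also have "\<dots> = (\<Sum>p\<in>{p. p permutes (UNIV::'m set)}. of_int (sign p) * (\<Prod>i\<in>UNIV. A $ \<pi> i $ \<pi> (p i)))"
  proof (rule sum.cong[OF refl])
    fix p :: "'m \<Rightarrow> 'm" assume "p \<in> {p. p permutes UNIV}"
    then have "sign (map_permutation UNIV \<pi> p) = sign p"
      by (intro sign_map_permutation inj) auto
    moreover have "(\<Prod>j\<in>UNIV. A $ j $ map_permutation UNIV \<pi> p j) = (\<Prod>i\<in>UNIV. A $ \<pi> i $ \<pi> (p i))"
      using prod.reindex_bij_betw[OF assms, of "\<lambda>j. A $ j $ map_permutation UNIV \<pi> p j"] by (simp add: mp)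
    ultimately show "of_int (sign (map_permutation UNIV \<pi> p)) * (\<Prod>j\<in>UNIV. A $ j $ map_permutation UNIV \<pi> p j)
        = (of_int (sign p) * (\<Prod>i\<in>UNIV. A $ \<pi> i $ \<pi> (p i)) :: real)" by simp
  qed
  finally show ?thesis by (simp add: det_def)
qed

definition reindex :: "('m \<Rightarrow> 'n) \<Rightarrow> real^'n \<Rightarrow> real^'m" where
  "reindex \<pi> x = (\<chi> i. x $ \<pi> i)"

lemma linear_reindex: "linear (reindex \<pi>)"
  by (rule linearI) (simp_all add: reindex_def vec_eq_iff)

lemma reindex_inv:
  assumes "bij \<pi>"
  shows "reindex \<pi> (reindex (inv \<pi>) x) = x" "reindex (inv \<pi>) (reindex \<pi> y) = y"
  using assms by (simp_all add: reindex_def vec_eq_iff bij_is_inj surj_f_inv_f bij_is_surj)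

text \<open>A relabelling of coordinates sends boxes to boxes with the same side lengths, and
  \<open>lborel\<close> is determined by its values on boxes.\<close>

lemma distr_lebesgue_reindex:
  fixes \<pi> :: "'m::finite \<Rightarrow> 'n::finite"
  assumes "bij \<pi>"
  shows "reindex \<pi> \<in> lebesgue \<rightarrow>\<^sub>M lebesgue" "distr lebesgue lebesgue (reindex \<pi>) = lebesgue"
proof -
  have m [measurable]: "reindex \<pi> \<in> borel_measurable borel"
    by (intro borel_measurable_continuous_onI linear_continuous_on linear_reindex
      linear_conv_bounded_linear[THEN iffD1])
  have "lborel = distr lborel borel (reindex \<pi>)"
  proof (rule lborel_eqI)
    fix l u :: "real^'m"
    assume le: "\<And>b. b \<in> Basis \<Longrightarrow> l \<bullet> b \<le> u \<bullet> b"
    have le': "l $ i \<le> u $ i" for i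
      using le[of "axis i 1"] by (auto simp: inner_axis Basis_vec_def)
    have "reindex \<pi> -` box l u = box (reindex (inv \<pi>) l) (reindex (inv \<pi>) u)"
      using assms
      by (auto simp: reindex_def box_def Basis_vec_def inner_axis)
         (metis bij_inv_eq_iff)+
    then have "emeasure (distr lborel borel (reindex \<pi>)) (box l u)
        = emeasure lborel (box (reindex (inv \<pi>) l) (reindex (inv \<pi>) u))"
      by (simp add: emeasure_distr)
    also have "\<dots> = (\<Prod>b\<in>Basis. (reindex (inv \<pi>) u - reindex (inv \<pi>) l) \<bullet> b)"
      using le' by (subst emeasure_lborel_box) (auto simp: Basis_vec_def inner_axis reindex_def)
    also have "(\<Prod>b\<in>Basis. (reindex (inv \<pi>) u - reindex (inv \<pi>) l) \<bullet> b) = (\<Prod>j\<in>UNIV. u $ inv \<pi> j - l $ inv \<pi> j)"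
      by (simp add: Basis_vec_def prod.UNION_disjoint axis_eq_axis inner_axis reindex_def
          prod.reindex inj_def UNION_singleton_eq_range)
    also have "\<dots> = (\<Prod>i\<in>UNIV. u $ i - l $ i)"
      using prod.reindex_bij_betw[OF bij_imp_bij_inv[OF assms], of "\<lambda>i. u $ i - l $ i"] by simp
    also have "\<dots> = (\<Prod>b\<in>Basis. (u - l) \<bullet> b)"
      by (simp add: Basis_vec_def axis_eq_axis inner_axis
          prod.reindex inj_def UNION_singleton_eq_range)
    finally show "emeasure (distr lborel borel (reindex \<pi>)) (box l u) = (\<Prod>b\<in>Basis. (u - l) \<bullet> b)" .
  qed simp
  \<comment> \<open>Passage to the completion: as the image measure is \<open>lborel\<close> itself,
    Borel null sets pull back to null sets, which is what measurability into the completed measure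
    asks for.\<close>
  then have eq: "distr lebesgue lborel (reindex \<pi>) = lborel"
    by (simp add: distr_completion cong: distr_cong)
  show "reindex \<pi> \<in> lebesgue \<rightarrow>\<^sub>M lebesgue"
    using eq by (intro completion.measurable_completion2) (auto simp: measurable_completion)
  have "distr lebesgue lebesgue (reindex \<pi>) = completion (distr lebesgue lborel (reindex \<pi>))"
    using eq by (intro completion.completion_distr_eq[symmetric]) (auto simp: measurable_completion)
  then show "distr lebesgue lebesgue (reindex \<pi>) = lebesgue"
    by (simp add: eq)
qed

lemma differentiable_image_lebesgue:
  fixes g :: "real^'n \<Rightarrow> real^'n"
  assumes "S \<in> sets lebesgue" and "\<And>x. x \<in> S \<Longrightarrow> (g has_derivative g' x) (at x within S)"
  shows "g ` S \<in> sets lebesgue"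
  using assms by (intro differentiable_image_in_sets_lebesgue) (auto intro: differentiableI simp: differentiable_on_def)

text \<open>\<open>has_absolute_integral_change_of_variables\<close> concerns vector-valued
  integrands and absolute gauge integrability. The scalar \<open>f\<close> is embedded into
  \<open>real^1\<close> by \<open>vec\<close>, its component is read off again, and both sides are
  converted to Bochner integrals over \<open>lebesgue_on\<close>.\<close>

lemma has_integral_change_of_variables_wellorder:
  fixes f :: "real^'m::{finite,wellorder} \<Rightarrow> real" and g :: "real^'m::_ \<Rightarrow> real^'m::_"
  assumes S: "S \<in> sets lebesgue"
    and der: "\<And>x. x \<in> S \<Longrightarrow> (g has_derivative g' x) (at x within S)"
    and inj: "inj_on g S"
    and f: "integrable (lebesgue_on (g ` S)) f"
  shows "has_bochner_integral (lebesgue_on S) (\<lambda>x. \<bar>det (matrix (g' x))\<bar> * f (g x))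
    (integral\<^sup>L (lebesgue_on (g ` S)) f)"
proof -
  have gS: "g ` S \<in> sets lebesgue"
    by (rule differentiable_image_lebesgue[OF S der])
  let ?h = "\<lambda>x. \<bar>det (matrix (g' x))\<bar> * f (g x)" and ?v = "\<lambda>t. (vec t :: real^1)"
  have f': "f absolutely_integrable_on g ` S"
    using f gS by (simp add: set_integrable_def integrable_restrict_space)
  have bl: "bounded_linear ?v" "bounded_linear (\<lambda>x::real^1. x $ 1)"
    by (auto intro!: linear_conv_bounded_linear[THEN iffD1] linearI simp: vec_eq_iff)
  have vf: "(\<lambda>y. ?v (f y)) absolutely_integrable_on g ` S"
    using absolutely_integrable_linear[OF f' bl(1)] by (simp add: o_def)
  have iv: "integral T (\<lambda>x. ?v (k x)) $ 1 = integral T k" if "(\<lambda>x. ?v (k x)) absolutely_integrable_on T" for k T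
    using integral_linear[of "\<lambda>x. ?v (k x)" T "\<lambda>x::real^1. x $ 1"] bl(2) that
    by (simp add: o_def absolutely_integrable_on_def)
  have vh: "?v (?h x) = \<bar>det (matrix (g' x))\<bar> *\<^sub>R ?v (f (g x))" for x
    by (simp add: vec_eq_iff)
  have h: "(\<lambda>x. ?v (?h x)) absolutely_integrable_on S \<and>
      integral S (\<lambda>x. ?v (?h x)) = integral (g ` S) (\<lambda>y. ?v (f y))"
    using has_absolute_integral_change_of_variables[OF S der inj, of "\<lambda>y. ?v (f y)"] vf
    unfolding vh by simp
  have "?h absolutely_integrable_on S"
    using absolutely_integrable_linear[OF conjunct1[OF h] bl(2)] by (simp add: o_def)
  then have int: "integrable (lebesgue_on S) ?h"
    using S by (simp add: set_integrable_def integrable_restrict_space)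
  have "integral\<^sup>L (lebesgue_on S) ?h = integral S ?h"
    using lebesgue_integral_eq_integral[OF int S] .
  also have "\<dots> = integral (g ` S) f"
    using iv[OF conjunct1[OF h]] iv[OF vf] arg_cong[OF conjunct2[OF h], of "\<lambda>z. z $ 1"]
    by (metis (no_types))
  also have "\<dots> = integral\<^sup>L (lebesgue_on (g ` S)) f"
    using lebesgue_integral_eq_integral[OF f gS] by simp
  finally show ?thesis
    using int by (simp add: has_bochner_integral_iff)
qed

lemma has_integral_reindex:
  fixes \<pi> :: "'m::finite \<Rightarrow> 'n::finite" and f :: "real^'m \<Rightarrow> real"
  assumes \<pi>: "bij \<pi>" and S: "S \<in> sets lebesgue" and f: "has_bochner_integral (lebesgue_on S) f I"
  shows "has_bochner_integral (lebesgue_on (reindex \<pi> -` S)) (\<lambda>x. f (reindex \<pi> x)) I"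
proof -
  note m = distr_lebesgue_reindex[OF \<pi>]
  have f': "has_bochner_integral lebesgue (\<lambda>x. indicator S x *\<^sub>R f x) I"
    using S f by (simp add: has_bochner_integral_restrict_space)
  have "has_bochner_integral lebesgue (\<lambda>x. indicator S (reindex \<pi> x) *\<^sub>R f (reindex \<pi> x)) I"
    using f' integrable_distr_eq[OF m(1) borel_measurable_has_bochner_integral[OF f']]
      integral_distr[OF m(1) borel_measurable_has_bochner_integral[OF f']]
    by (simp add: m(2) has_bochner_integral_iff)
  moreover have "reindex \<pi> -` S \<in> sets lebesgue"
    using measurable_sets[OF m(1) S] by simp
  ultimately show ?thesis
    by (simp add: has_bochner_integral_restrict_space indicator_def)
qed

text \<open>\<open>g\<close> is conjugated by the coordinate relabellings \<open>P\<close> and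
  \<open>Q\<close>, which preserve Lebesgue measure; the well-ordered version applies to the
  conjugate, and the result is carried back.\<close>

lemma has_integral_change_of_variables:
  fixes f :: "real^'n \<Rightarrow> real" and g :: "real^'n \<Rightarrow> real^'n"
  assumes S: "S \<in> sets lebesgue"
    and der: "\<And>x. x \<in> S \<Longrightarrow> (g has_derivative g' x) (at x within S)"
    and inj: "inj_on g S"
    and f: "integrable (lebesgue_on (g ` S)) f"
  shows "has_bochner_integral (lebesgue_on S) (\<lambda>x. \<bar>det (matrix (g' x))\<bar> * f (g x))
    (integral\<^sup>L (lebesgue_on (g ` S)) f)"
proof -
  obtain \<pi> :: "'n index \<Rightarrow> 'n" where \<pi>: "bij \<pi>"
    using finite_same_card_bij[of "UNIV :: 'n index set" "UNIV :: 'n set"] card_index by auto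
  define P where "P = reindex (inv \<pi>)"
  define Q where "Q = reindex \<pi>"
  have PQ [simp]: "P (Q x) = x" "Q (P y) = y" for x y
    using reindex_inv[OF \<pi>] by (simp_all add: P_def Q_def)
  have blP: "bounded_linear P" and blQ: "bounded_linear Q"
    by (simp_all add: P_def Q_def linear_reindex linear_conv_bounded_linear[symmetric])
  let ?S = "P -` S" and ?g = "\<lambda>x. Q (g (P x))" and ?g' = "\<lambda>x h. Q (g' (P x) (P h))"
  have gS: "g ` S \<in> sets lebesgue"
    by (rule differentiable_image_lebesgue[OF S der])
  have S': "?S \<in> sets lebesgue"
    using measurable_sets[OF distr_lebesgue_reindex(1)[OF bij_imp_bij_inv[OF \<pi>]] S] by (simp add: P_def)
  have der': "(?g has_derivative ?g' x) (at x within ?S)" if "x \<in> ?S" for x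
  proof -
    have "(P has_derivative P) (at x within ?S)"
      using blP by (rule bounded_linear.has_derivative) (rule has_derivative_ident)
    moreover have "(g has_derivative g' (P x)) (at (P x) within P ` ?S)"
      using der that by (auto intro: has_derivative_subset)
    ultimately have "(g \<circ> P has_derivative g' (P x) \<circ> P) (at x within ?S)"
      by (rule diff_chain_within)
    then show ?thesis
      using bounded_linear.has_derivative[OF blQ] by (fastforce simp: o_def)
  qed
  have inj': "inj_on ?g ?S"
    using inj by (auto simp: inj_on_def) (metis PQ)+
  have img: "?g ` ?S = P -` g ` S"
    by (auto simp: image_iff) (metis PQ vimageI2)
  have f': "has_bochner_integral (lebesgue_on (?g ` ?S)) (\<lambda>x. f (P x)) (integral\<^sup>L (lebesgue_on (g ` S)) f)"
    unfolding img using has_integral_reindex[OF bij_imp_bij_inv[OF \<pi>] gS] f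
    by (simp add: P_def has_bochner_integral_integrable)
  have "has_bochner_integral (lebesgue_on ?S) (\<lambda>x. \<bar>det (matrix (?g' x))\<bar> * f (P (?g x)))
      (integral\<^sup>L (lebesgue_on (g ` S)) f)"
    using has_integral_change_of_variables_wellorder[OF S' der' inj', of "\<lambda>x. f (P x)"] f'
    by (simp add: has_bochner_integral_iff)
  from has_integral_reindex[OF \<pi> S' this]
  have "has_bochner_integral (lebesgue_on (Q -` ?S)) (\<lambda>x. \<bar>det (matrix (?g' (Q x)))\<bar> * f (P (?g (Q x))))
      (integral\<^sup>L (lebesgue_on (g ` S)) f)"
    by (simp add: Q_def)
  \<comment> \<open>\<open>P\<close> sends the basis vector \<open>j\<close> to the basis vector
    \<open>\<pi> j\<close>, so conjugation relabels the rows and columns of \<open>matrix L\<close>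
    simultaneously and \<open>det_reindex\<close> applies.\<close>
  moreover have "det (matrix (\<lambda>h. Q (L (P h)))) = det (matrix L)" for L :: "real^'n \<Rightarrow> real^'n"
  proof -
    have "P (axis j 1) = axis (\<pi> j) 1" for j
      using \<pi> by (auto simp: P_def reindex_def vec_eq_iff axis_def bij_inv_eq_iff) (metis bij_inv_eq_iff)+
    then have "matrix (\<lambda>h. Q (L (P h))) = (\<chi> i j. matrix L $ \<pi> i $ \<pi> j)"
      by (simp add: matrix_def Q_def reindex_def)
    then show ?thesis
      using det_reindex[OF \<pi>] by simp
  qed
  moreover have "Q -` ?S = S" by auto
  ultimately show ?thesis by simp
qed

section \<open>Essentially bounded functions\<close>

text \<open>A class closed under sums, products and changes on null sets, and one whose members
  multiply integrable functions into integrable ones. Pointwise bounds would fail for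
  \<open>grad\<close>, whose skeleton values are arbitrary.\<close>

definition ess_bounded :: "'a::euclidean_space set \<Rightarrow> ('a \<Rightarrow> 'b::euclidean_space) \<Rightarrow> bool" where
  "ess_bounded \<Omega> f \<longleftrightarrow>
     f \<in> borel_measurable (lebesgue_on \<Omega>) \<and> (\<exists>B. AE x in lebesgue_on \<Omega>. norm (f x) \<le> B)"

lemma ess_bounded_const: "ess_bounded \<Omega> (\<lambda>x. c)"
  by (auto simp: ess_bounded_def)

lemma ess_bounded_add:
  assumes "ess_bounded \<Omega> f" "ess_bounded \<Omega> g"
  shows "ess_bounded \<Omega> (\<lambda>x. f x + g x)"
proof -
  obtain B C where "AE x in lebesgue_on \<Omega>. norm (f x) \<le> B" "AE x in lebesgue_on \<Omega>. norm (g x) \<le> C"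
    using assms by (auto simp: ess_bounded_def)
  then have "AE x in lebesgue_on \<Omega>. norm (f x + g x) \<le> B + C"
    by eventually_elim (rule norm_triangle_mono)
  then show ?thesis
    using assms by (auto simp: ess_bounded_def)
qed

lemma ess_bounded_scaleR:
  assumes "ess_bounded \<Omega> a" "ess_bounded \<Omega> f"
  shows "ess_bounded \<Omega> (\<lambda>x. a x *\<^sub>R f x)"
proof -
  obtain B C where "AE x in lebesgue_on \<Omega>. norm (a x) \<le> B" "AE x in lebesgue_on \<Omega>. norm (f x) \<le> C"
    using assms by (auto simp: ess_bounded_def)
  then have "AE x in lebesgue_on \<Omega>. norm (a x *\<^sub>R f x) \<le> B * C"
    by eventually_elim (auto intro!: mult_mono')
  then show ?thesis
    using assms by (auto simp: ess_bounded_def)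
qed

lemma ess_bounded_diff:
  assumes "ess_bounded \<Omega> f" "ess_bounded \<Omega> g"
  shows "ess_bounded \<Omega> (\<lambda>x. f x - g x)"
  using ess_bounded_add[OF assms(1) ess_bounded_scaleR[OF ess_bounded_const[of \<Omega> "-1"] assms(2)]] by simp

text \<open>Lebesgue measure is complete, so even the measurability of \<open>g\<close> is inherited
  from \<open>f\<close>. This is how a carrier given only almost everywhere becomes
  measurable.\<close>

lemma ess_bounded_AE:
  assumes "ess_bounded \<Omega> f" and \<Omega>: "\<Omega> \<in> sets lebesgue" and eq: "AE x in lebesgue_on \<Omega>. f x = g x"
  shows "ess_bounded \<Omega> g"
proof -
  have "(\<lambda>x. indicator \<Omega> x *\<^sub>R f x) \<in> borel_measurable lebesgue"
    using assms by (simp add: ess_bounded_def borel_measurable_restrict_space_iff)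
  moreover have "AE x in lebesgue. indicator \<Omega> x *\<^sub>R f x = indicator \<Omega> x *\<^sub>R g x"
    using eq \<Omega> by (auto simp: AE_restrict_space_iff indicator_def elim!: eventually_mono)
  ultimately have "(\<lambda>x. indicator \<Omega> x *\<^sub>R g x) \<in> borel_measurable lebesgue"
    by (rule borel_measurable_AE)
  then have "g \<in> borel_measurable (lebesgue_on \<Omega>)"
    using \<Omega> by (simp add: borel_measurable_restrict_space_iff)
  moreover obtain B where "AE x in lebesgue_on \<Omega>. norm (f x) \<le> B"
    using assms by (auto simp: ess_bounded_def)
  then have "AE x in lebesgue_on \<Omega>. norm (g x) \<le> B"
    using eq by eventually_elim simp
  ultimately show ?thesis
    by (auto simp: ess_bounded_def)
qed

lemma AE_lebesgue_on_iff:
  assumes "\<Omega> \<in> sets lebesgue"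
  shows "(AE x in lebesgue_on \<Omega>. P x) \<longleftrightarrow> negligible {x \<in> \<Omega>. \<not> P x}"
  using assms
  by (simp add: AE_restrict_space_iff completion.AE_iff_null_sets negligible_iff_null_sets)

text \<open>On the null set \<open>\<Omega> - U\<close> the values may be wild. Cutting
  \<open>f\<close> off to zero outside \<open>U\<close> gives a bounded measurable function that
  differs from \<open>f\<close> only there.\<close>

lemma ess_bounded_continuous_on:
  assumes \<Omega>: "\<Omega> \<in> sets lebesgue" and U: "open U" "negligible (\<Omega> - U)"
    and f: "continuous_on U f" "bounded (f ` U)"
  shows "ess_bounded \<Omega> f"
proof -
  have mU: "U \<in> sets lebesgue" using U by simp
  have "(\<lambda>x. indicator U x *\<^sub>R f x) \<in> borel_measurable lebesgue"
    using continuous_imp_measurable_on_sets_lebesgue[OF f(1) mU] mU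
    by (simp add: borel_measurable_restrict_space_iff)
  then have "(\<lambda>x. indicator U x *\<^sub>R f x) \<in> borel_measurable (lebesgue_on \<Omega>)"
    by (rule measurable_restrict_space1)
  moreover obtain B where B: "\<And>x. x \<in> U \<Longrightarrow> norm (f x) \<le> B"
    using f(2) by (auto simp: bounded_iff)
  have "norm (indicator U x *\<^sub>R f x) \<le> max 0 B" for x
    using B[of x] by (auto simp: indicator_def)
  ultimately have "ess_bounded \<Omega> (\<lambda>x. indicator U x *\<^sub>R f x)"
    by (auto simp: ess_bounded_def)
  moreover have "negligible {x \<in> \<Omega>. \<not> indicator U x *\<^sub>R f x = f x}"
    by (rule negligible_subset[OF U(2)]) (auto simp: indicator_def)
  ultimately show ?thesis
    using ess_bounded_AE \<Omega> AE_lebesgue_on_iff by blast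
qed

text \<open>Hoelder's inequality with exponents 1 and infinity.\<close>

lemma integrable_inner_ess_bounded:
  assumes f: "integrable (lebesgue_on \<Omega>) f" and g: "ess_bounded \<Omega> g"
  shows "integrable (lebesgue_on \<Omega>) (\<lambda>x. f x \<bullet> g x)"
proof -
  obtain B where B: "AE x in lebesgue_on \<Omega>. norm (g x) \<le> B"
    using g by (auto simp: ess_bounded_def)
  show ?thesis
  proof (rule Bochner_Integration.integrable_bound)
    show "integrable (lebesgue_on \<Omega>) (\<lambda>x. B *\<^sub>R f x)"
      using f by simp
    show "AE x in lebesgue_on \<Omega>. norm (f x \<bullet> g x) \<le> norm (B *\<^sub>R f x)"
      using B
    proof eventually_elim
      case (elim x)
      have "norm (f x \<bullet> g x) \<le> norm (f x) * norm (g x)"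
        by (simp add: Cauchy_Schwarz_ineq2)
      also have "\<dots> \<le> norm (f x) * \<bar>B\<bar>"
        using elim by (intro mult_left_mono) auto
      finally show ?case by (simp add: mult.commute)
    qed
  qed (use f g in \<open>auto simp: ess_bounded_def\<close>)
qed

lemma ess_bounded_integrable:
  assumes "\<Omega> \<in> lmeasurable" and f: "ess_bounded \<Omega> f"
  shows "integrable (lebesgue_on \<Omega>) f"
proof -
  obtain B where "AE x in lebesgue_on \<Omega>. norm (f x) \<le> B"
    using f by (auto simp: ess_bounded_def)
  moreover have "integrable (lebesgue_on \<Omega>) (\<lambda>x. B)"
    using assms(1) by (intro finite_measure.integrable_const finite_measure_lebesgue_on)
  ultimately show ?thesis
    using f by (intro Bochner_Integration.integrable_bound[of _ "\<lambda>x. B" f])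
      (auto simp: ess_bounded_def elim: eventually_mono)
qed

lemma L2_inner_eq:
  assumes "\<Omega> \<in> sets lebesgue"
  shows "L2_inner \<Omega> f g = integral\<^sup>L (lebesgue_on \<Omega>) (\<lambda>x. f x \<bullet> g x)"
  using assms by (simp add: L2_inner_def set_lebesgue_integral_def integral_restrict_space)

lemma L2_integrable:
  assumes \<Omega>: "\<Omega> \<in> lmeasurable" and f: "f \<in> L2 \<Omega>"
  shows "integrable (lebesgue_on \<Omega>) f"
proof (rule Bochner_Integration.integrable_bound)
  have "integrable (lebesgue_on \<Omega>) (\<lambda>x. (norm (f x))\<^sup>2)"
    using \<Omega> f by (simp add: L2_def set_integrable_def integrable_restrict_space)
  then show "integrable (lebesgue_on \<Omega>) (\<lambda>x. 1 + (norm (f x))\<^sup>2)"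
    using ess_bounded_integrable[OF \<Omega> ess_bounded_const[of \<Omega> "1::real"]] by simp
  \<comment> \<open>Expanding the square of \<open>2 * t - 1\<close> even gives the bound with 1/4
    in place of 1.\<close>
  have "t \<le> 1 + t\<^sup>2" for t :: real
    using zero_le_power2[of "2 * t - 1"] by (simp add: power2_eq_square algebra_simps)
  then show "AE x in lebesgue_on \<Omega>. norm (f x) \<le> norm (1 + (norm (f x))\<^sup>2)"
    by (intro AE_I2) (simp only: real_norm_def order_trans[OF _ abs_ge_self])
qed (use f in \<open>simp add: L2_def\<close>)

lemma ess_bounded_L2:
  assumes \<Omega>: "\<Omega> \<in> lmeasurable" and f: "ess_bounded \<Omega> f"
  shows "f \<in> L2 \<Omega>"
proof -
  have "integrable (lebesgue_on \<Omega>) (\<lambda>x. (norm (f x))\<^sup>2)"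
    using integrable_inner_ess_bounded[OF ess_bounded_integrable[OF \<Omega> f] f] by (simp add: power2_norm_eq_inner)
  then show ?thesis
    using \<Omega> f by (simp add: L2_def set_integrable_def integrable_restrict_space ess_bounded_def)
qed

section \<open>Gradients and finite element functions\<close>

lemma grad_eqI:
  assumes "(v has_derivative (\<lambda>h. w \<bullet> h)) (at x)"
  shows "grad v x = w"
  by (simp add: grad_def vec_eq_iff frechet_derivative_at[OF assms, symmetric] inner_axis)

lemma has_derivative_grad:
  assumes "v differentiable (at x)"
  shows "(v has_derivative (\<lambda>h. grad v x \<bullet> h)) (at x)"
proof -
  have d: "(v has_derivative frechet_derivative v (at x)) (at x)"
    using assms frechet_derivative_works by blast
  then interpret linear "frechet_derivative v (at x)"
    by (rule has_derivative_linear)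
  have "frechet_derivative v (at x) h = grad v x \<bullet> h" for h
  proof -
    have "frechet_derivative v (at x) h = frechet_derivative v (at x) (\<Sum>i\<in>UNIV. h $ i *\<^sub>R axis i 1)"
      by (simp add: scalar_mult_eq_scaleR[symmetric] basis_expansion)
    also have "\<dots> = grad v x \<bullet> h"
      by (simp add: sum scaleR inner_vec_def grad_def mult.commute)
    finally show ?thesis .
  qed
  then show ?thesis using d by presburger
qed

text \<open>Differentiability is not needed: the two functions have the same derivatives at \<open>x\<close>, and
  \<^const>\<open>frechet_derivative\<close> chooses among these.\<close>

lemma grad_cong_add_const:
  assumes "open U" "x \<in> U" and eq: "\<And>y. y \<in> U \<Longrightarrow> v y = w y + c"
  shows "grad v x = grad w x"
proof -
  have "(v has_derivative D) (at x) \<longleftrightarrow> (w has_derivative D) (at x)" for D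
  proof
    assume "(v has_derivative D) (at x)"
    then have "((\<lambda>y. v y - c) has_derivative D) (at x)"
      using has_derivative_diff[of v D "at x" "\<lambda>y. c" "\<lambda>h. 0"] by simp
    then show "(w has_derivative D) (at x)"
      by (rule has_derivative_transform_within_open[OF _ assms(1,2)]) (simp add: eq)
  next
    assume "(w has_derivative D) (at x)"
    then have "((\<lambda>y. w y + c) has_derivative D) (at x)"
      using has_derivative_add[of w D "at x" "\<lambda>y. c" "\<lambda>h. 0"] by simp
    then show "(v has_derivative D) (at x)"
      by (rule has_derivative_transform_within_open[OF _ assms(1,2)]) (simp add: eq)
  qed
  then show ?thesis
    by (simp add: grad_def frechet_derivative_def)
qed

lemma grad_const: "grad (\<lambda>x. c) = (\<lambda>x. 0)"
  by (rule ext, rule grad_eqI) simp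

text \<open>The intersection with \<open>\<Omega>\<close> matters: cells fill
  \<open>closure \<Omega>\<close>, and \<open>polyhedral_domain\<close> admits domains with slits,
  so a cell interior may leave \<open>\<Omega>\<close>.\<close>

definition mesh_interior :: "(real^'n) set \<Rightarrow> (real^'n) set set \<Rightarrow> (real^'n) set" where
  "mesh_interior \<Omega> T = \<Omega> \<inter> (\<Union>K\<in>T. interior K)"

lemma polyhedral_domain_lmeasurable: "polyhedral_domain \<Omega> \<Longrightarrow> \<Omega> \<in> lmeasurable"
  by (simp add: polyhedral_domain_def lmeasurable_open)

lemma polyhedral_domain_sets: "polyhedral_domain \<Omega> \<Longrightarrow> \<Omega> \<in> sets lebesgue"
  by (simp add: polyhedral_domain_lmeasurable fmeasurableD)

lemma open_mesh_interior: "polyhedral_domain \<Omega> \<Longrightarrow> open (mesh_interior \<Omega> T)"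
  unfolding mesh_interior_def polyhedral_domain_def by (intro open_Int open_UN) auto

lemma mesh_interior_subset: "mesh_interior \<Omega> T \<subseteq> \<Omega>"
  by (auto simp: mesh_interior_def)

lemma triangulation_cell:
  assumes "conforming_triangulation \<Omega> T" "K \<in> T"
  shows "compact K" "convex K" "closed K" "K \<subseteq> closure \<Omega>"
  using assms unfolding conforming_triangulation_def
  by (blast intro: compact_simplex convex_simplex closed_simplex)+

text \<open>Cells are convex, and the frontier of a convex set is negligible; there are finitely
  many cells.\<close>

lemma negligible_skeleton:
  assumes T: "conforming_triangulation \<Omega> T"
  shows "negligible (\<Omega> - mesh_interior \<Omega> T)"
proof (rule negligible_subset)
  have "finite T" "\<Omega> \<subseteq> \<Union>T"
    using T closure_subset[of \<Omega>] by (auto simp: conforming_triangulation_def triangulation_def)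
  show "negligible (\<Union>(frontier ` T))"
    using \<open>finite T\<close> triangulation_cell[OF T] by (intro negligible_Union) (auto intro: negligible_convex_frontier)
  show "\<Omega> - mesh_interior \<Omega> T \<subseteq> \<Union>(frontier ` T)"
  proof
    fix x assume x: "x \<in> \<Omega> - mesh_interior \<Omega> T"
    then obtain K where K: "K \<in> T" "x \<in> K"
      using \<open>\<Omega> \<subseteq> \<Union>T\<close> by blast
    then have "x \<in> frontier K"
      using x closure_subset[of K] by (auto simp: mesh_interior_def frontier_def)
    then show "x \<in> \<Union>(frontier ` T)"
      using K by blast
  qed
qed

lemma fe_function_differentiable:
  assumes "v \<in> fe_functions \<Omega> T" "x \<in> mesh_interior \<Omega> T"
  shows "v differentiable (at x)"
  using assms differentiable_on_eq_differentiable_at[OF open_interior]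
  by (auto simp: fe_functions_def mesh_interior_def)

text \<open>Continuity is local, so it passes from single open cells to their union; the gradient
  bounds combine because a triangulation is finite.\<close>

lemma fe_function_regular:
  assumes T: "conforming_triangulation \<Omega> T" and v: "v \<in> fe_functions \<Omega> T"
  shows "continuous_on (mesh_interior \<Omega> T) v" "bounded (v ` \<Omega>)"
    "continuous_on (mesh_interior \<Omega> T) (grad v)" "bounded (grad v ` mesh_interior \<Omega> T)"
proof -
  show "continuous_on (mesh_interior \<Omega> T) v"
    using fe_function_differentiable[OF v]
    by (meson continuous_at_imp_continuous_on differentiable_imp_continuous_within)
  show "bounded (v ` \<Omega>)"
    using v by (simp add: fe_functions_def)
  have "continuous_on (\<Union>(interior ` T)) (grad v)"
    using v by (intro continuous_on_open_Union) (auto simp: fe_functions_def)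
  then show "continuous_on (mesh_interior \<Omega> T) (grad v)"
    by (rule continuous_on_subset) (auto simp: mesh_interior_def)
  have "bounded (\<Union>K\<in>T. grad v ` interior K)"
    using v T by (intro bounded_UN) (auto simp: fe_functions_def conforming_triangulation_def triangulation_def)
  then show "bounded (grad v ` mesh_interior \<Omega> T)"
    by (rule bounded_subset) (auto simp: mesh_interior_def)
qed

lemma mesh_regular_ess_bounded:
  assumes "polyhedral_domain \<Omega>" "conforming_triangulation \<Omega> T"
    and "continuous_on (mesh_interior \<Omega> T) f" "bounded (f ` mesh_interior \<Omega> T)"
  shows "ess_bounded \<Omega> f"
  using assms by (intro ess_bounded_continuous_on[OF polyhedral_domain_sets open_mesh_interior negligible_skeleton])

lemma fe_function_ess_bounded:
  assumes "polyhedral_domain \<Omega>" "conforming_triangulation \<Omega> T" "v \<in> fe_functions \<Omega> T"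
  shows "ess_bounded \<Omega> v" "ess_bounded \<Omega> (grad v)"
  using fe_function_regular[OF assms(2,3)] assms(1,2)
  by (auto intro!: mesh_regular_ess_bounded intro: bounded_subset[OF _ image_mono[OF mesh_interior_subset]])

lemma vector_fe_function_regular:
  assumes T: "conforming_triangulation \<Omega> T" and V: "vector_fe_space \<Omega> T V" "u \<in> V"
  shows "continuous_on (mesh_interior \<Omega> T) u" "bounded (u ` \<Omega>)"
proof -
  have u: "(\<lambda>x. u x $ i) \<in> fe_functions \<Omega> T" for i
    using V by (simp add: vector_fe_space_def)
  note r = fe_function_regular[OF T u]
  have "continuous_on (mesh_interior \<Omega> T) (\<lambda>x. \<chi> i. u x $ i)"
    using r(1) by (rule continuous_on_vec_lambda)
  then show "continuous_on (mesh_interior \<Omega> T) u" by simp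
  have "\<exists>B. \<forall>x\<in>\<Omega>. \<bar>u x $ i\<bar> \<le> B" for i
    using r(2)[of i] by (auto simp: bounded_iff)
  then obtain B where B: "\<And>i x. x \<in> \<Omega> \<Longrightarrow> \<bar>u x $ i\<bar> \<le> B i" by metis
  have "norm (u x) \<le> (\<Sum>i\<in>UNIV. B i)" if "x \<in> \<Omega>" for x
    using norm_le_l1_cart[of "u x"] sum_mono[of UNIV "\<lambda>i. \<bar>u x $ i\<bar>" B] B[OF that] by (auto intro: order_trans)
  then show "bounded (u ` \<Omega>)" by (auto simp: bounded_iff)
qed

lemma vector_fe_function_ess_bounded:
  assumes "polyhedral_domain \<Omega>" "conforming_triangulation \<Omega> T" "vector_fe_space \<Omega> T V" "u \<in> V"
  shows "ess_bounded \<Omega> u"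
  using vector_fe_function_regular[OF assms(2-4)] assms(1,2)
  by (auto intro!: mesh_regular_ess_bounded intro: bounded_subset[OF _ image_mono[OF mesh_interior_subset]])

lemma ess_bounded_extrapolation:
  assumes "\<And>l. ess_bounded \<Omega> (z l)"
  shows "ess_bounded \<Omega> (extrapolation k n z)"
  unfolding extrapolation_def[abs_def] using assms
  by (cases "k = 1") (auto intro!: ess_bounded_diff ess_bounded_scaleR ess_bounded_const)

lemma finite_dim_space_diff_scale:
  assumes "finite_dim_space S" "v \<in> S" "w \<in> S"
  shows "(\<lambda>x. v x - c *\<^sub>R w x) \<in> S"
proof -
  obtain B where B: "S = range (\<lambda>c x. \<Sum>b\<in>B. c b *\<^sub>R b x)"
    using assms(1) by (auto simp: finite_dim_space_def)
  obtain a a' where "v = (\<lambda>x. \<Sum>b\<in>B. a b *\<^sub>R b x)" "w = (\<lambda>x. \<Sum>b\<in>B. a' b *\<^sub>R b x)"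
    using assms(2,3) B by auto
  then have "(\<lambda>x. v x - c *\<^sub>R w x) = (\<lambda>x. \<Sum>b\<in>B. (a b - c * a' b) *\<^sub>R b x)"
    by (auto simp: scaleR_sum_right sum_subtractf scaleR_left_diff_distrib)
  then show ?thesis using B by auto
qed

text \<open>Since gradients ignore constants, testing against zero-mean functions suffices.\<close>

lemma orthogonal_grad_of_zero_mean:
  assumes \<Omega>: "polyhedral_domain \<Omega>" and T: "conforming_triangulation \<Omega> T" and S: "fe_space \<Omega> T S"
    and one: "e \<in> S" "\<And>x. x \<in> \<Omega> \<Longrightarrow> e x = 1"
    and orth: "\<And>\<eta>. \<eta> \<in> zero_mean \<Omega> S \<Longrightarrow> L2_inner \<Omega> w (grad \<eta>) = 0"
    and \<eta>: "\<eta> \<in> S"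
  shows "L2_inner \<Omega> w (grad \<eta>) = 0"
proof -
  have op: "open \<Omega>" "\<Omega> \<noteq> {}" using \<Omega> by (auto simp: polyhedral_domain_def)
  note meas = polyhedral_domain_lmeasurable[OF \<Omega>] polyhedral_domain_sets[OF \<Omega>]
  \<comment> \<open>The mean value of \<open>\<eta>\<close>; the volume is nonzero because
    \<open>\<Omega>\<close> is open and nonempty.\<close>
  define c where "c = integral\<^sup>L (lebesgue_on \<Omega>) \<eta> / measure lebesgue \<Omega>"
  have vol: "measure lebesgue \<Omega> \<noteq> 0"
    using op meas(1) open_not_negligible negligible_iff_measure0 by blast
  \<comment> \<open>The constant is subtracted through \<open>e\<close>, a member of
    \<open>S\<close> known to equal 1 on \<open>\<Omega>\<close> only: a reference space is merely
    known to contain some function that agrees there with the pullback of 1.\<close>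
  let ?\<eta> = "\<lambda>x. \<eta> x - c *\<^sub>R e x"
  have \<eta>': "?\<eta> \<in> S"
    using S \<eta> one by (intro finite_dim_space_diff_scale) (auto simp: fe_space_def)
  have int: "integrable (lebesgue_on \<Omega>) \<eta>"
    using S \<eta> by (intro ess_bounded_integrable fe_function_ess_bounded[OF \<Omega> T] meas) (auto simp: fe_space_def)
  have intc: "integrable (lebesgue_on \<Omega>) (\<lambda>x. c)"
    using meas by (intro finite_measure.integrable_const finite_measure_lebesgue_on)
  have "integral\<^sup>L (lebesgue_on \<Omega>) ?\<eta> = integral\<^sup>L (lebesgue_on \<Omega>) (\<lambda>x. \<eta> x - c)"
    using one(2) by (intro Bochner_Integration.integral_cong) auto
  also have "\<dots> = integral\<^sup>L (lebesgue_on \<Omega>) \<eta> - c * measure lebesgue \<Omega>"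
    using int intc meas by (simp add: measure_restrict_space)
  also have "\<dots> = 0"
    using vol by (simp add: c_def)
  finally have "?\<eta> \<in> zero_mean \<Omega> S"
    using \<eta>' meas by (simp add: zero_mean_def set_lebesgue_integral_def integral_restrict_space)
  then have "L2_inner \<Omega> w (grad ?\<eta>) = 0" by (rule orth)
  moreover have "grad ?\<eta> x = grad \<eta> x" if "x \<in> \<Omega>" for x
    using op(1) that by (rule grad_cong_add_const[where c = "-c"]) (simp add: one)
  then have "L2_inner \<Omega> w (grad ?\<eta>) = L2_inner \<Omega> w (grad \<eta>)"
    unfolding L2_inner_eq[OF meas(2)] by (intro Bochner_Integration.integral_cong) auto
  ultimately show ?thesis by simp
qed

lemma L2_inner_diff:
  assumes \<Omega>: "\<Omega> \<in> lmeasurable"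
    and "integrable (lebesgue_on \<Omega>) f" "integrable (lebesgue_on \<Omega>) g" "ess_bounded \<Omega> h"
  shows "L2_inner \<Omega> (\<lambda>x. f x - g x) h = L2_inner \<Omega> f h - L2_inner \<Omega> g h"
  using integrable_inner_ess_bounded[OF assms(2,4)] integrable_inner_ess_bounded[OF assms(3,4)]
  by (simp add: L2_inner_eq[OF fmeasurableD[OF \<Omega>]] inner_diff_left)

lemma L2_inner_cong_AE:
  assumes "\<Omega> \<in> sets lebesgue" and "AE x in lebesgue_on \<Omega>. f x = g x"
    and "ess_bounded \<Omega> f" "ess_bounded \<Omega> g" "ess_bounded \<Omega> h"
  shows "L2_inner \<Omega> f h = L2_inner \<Omega> g h"
  unfolding L2_inner_eq[OF assms(1)]
  using assms by (intro integral_cong_AE) (auto simp: ess_bounded_def)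

section \<open>Carrier corrections\<close>

text \<open>\<open>uc\<close> agrees only almost everywhere with the corrected field, so both its
  square integrability and its pairings are taken from that representative.\<close>

lemma topology_changing_carrier_admissible:
  assumes \<Omega>: "polyhedral_domain \<Omega>" and T: "conforming_triangulation \<Omega> T" and S: "fe_space \<Omega> T S"
    and one: "(\<lambda>x. 1) \<in> S" and uE: "ess_bounded \<Omega> uE"
    and uc: "topology_changing_carrier \<Omega> S uE uc"
  shows "admissible_carrier \<Omega> S uc"
proof -
  note meas = polyhedral_domain_lmeasurable[OF \<Omega>] polyhedral_domain_sets[OF \<Omega>]
  obtain lam where lam: "lam \<in> zero_mean \<Omega> S"
    and eq: "\<And>\<eta>. \<eta> \<in> zero_mean \<Omega> S \<Longrightarrow> L2_inner \<Omega> (grad lam) (grad \<eta>) = L2_inner \<Omega> uE (grad \<eta>)"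
    and uc_eq: "AE x in lebesgue_on \<Omega>. uc x = uE x - grad lam x"
    using uc by (auto simp: topology_changing_carrier_def)
  have grad: "ess_bounded \<Omega> (grad v)" if "v \<in> S" for v
    using S that fe_function_ess_bounded(2)[OF \<Omega> T] by (auto simp: fe_space_def)
  have lam': "ess_bounded \<Omega> (grad lam)"
    using lam grad by (simp add: zero_mean_def)
  have w: "ess_bounded \<Omega> (\<lambda>x. uE x - grad lam x)"
    using uE lam' by (rule ess_bounded_diff)
  have uc': "ess_bounded \<Omega> uc"
    using uc_eq by (intro ess_bounded_AE[OF w meas(2)]) (auto elim: eventually_mono)
  have "L2_inner \<Omega> uc (grad \<eta>) = 0" if "\<eta> \<in> zero_mean \<Omega> S" for \<eta>
  proof -
    have g: "ess_bounded \<Omega> (grad \<eta>)"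
      using that grad by (simp add: zero_mean_def)
    have "L2_inner \<Omega> uc (grad \<eta>) = L2_inner \<Omega> (\<lambda>x. uE x - grad lam x) (grad \<eta>)"
      by (rule L2_inner_cong_AE[OF meas(2) uc_eq uc' w g])
    also have "\<dots> = 0"
      using eq[OF that] meas(1) g uE lam' by (simp add: L2_inner_diff ess_bounded_integrable)
    finally show ?thesis .
  qed
  then have "L2_inner \<Omega> uc (grad \<eta>) = 0" if "\<eta> \<in> S" for \<eta>
    using orthogonal_grad_of_zero_mean[OF \<Omega> T S one] that by blast
  then show ?thesis
    using ess_bounded_L2[OF meas(1) uc'] by (simp add: admissible_carrier_def)
qed

section \<open>Regularity of mesh maps and Piola transforms\<close>

lemma continuous_on_det_nth:
  fixes A :: "'a::topological_space \<Rightarrow> real^'n^'n"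
  assumes "\<And>i j. continuous_on S (\<lambda>x. A x $ i $ j)"
  shows "continuous_on S (\<lambda>x. det (A x))"
  unfolding det_def by (intro continuous_intros assms)

text \<open>By Cramer's rule the entries of the inverse are quotients of determinants, hence
  continuous where the determinant is positive.\<close>

lemma continuous_on_matrix_inv: "continuous_on {A::real^'n^'n. 0 < det A} matrix_inv"
proof -
  have "matrix_inv A = (\<chi> k j. det (\<chi> i l. if l = k then axis j 1 $ i else A $ i $ l) / det A)"
    if "0 < det A" for A :: "real^'n^'n"
  proof -
    \<comment> \<open>\<open>matrix_inv\<close> is a choice among two-sided inverses, so the
      existence of one has to be shown before its defining property can be used.\<close>
    have "\<exists>A'. A ** A' = mat 1 \<and> A' ** A = mat 1"
      using that by (simp flip: invertible_def add: invertible_det_nz)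
    then have "A ** matrix_inv A = mat 1"
      unfolding matrix_inv_def by (rule someI2_ex) simp
    then have "A *v (matrix_inv A *v axis j 1) = axis j 1" for j
      by (simp add: matrix_vector_mul_assoc)
    then have "matrix_inv A *v axis j 1 = (\<chi> k. det (\<chi> i l. if l = k then axis j 1 $ i else A $ i $ l) / det A)" for j
      using cramer[of A] that by auto
    then show ?thesis
      by (simp add: matrix_vector_mult_basis column_def vec_eq_iff)
  qed
  moreover have "continuous_on X (\<lambda>A::real^'n^'n. if l = k then axis j 1 $ i else A $ i $ l)" for X i j k l
    by (cases "l = k") (auto intro!: continuous_intros)
  then have "continuous_on {A::real^'n^'n. 0 < det A}
      (\<lambda>A. \<chi> k j. det (\<chi> i l. if l = k then axis j 1 $ i else A $ i $ l) / det A)"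
    by (intro continuous_on_vec_lambda continuous_on_divide continuous_on_det_nth)
       (auto intro!: continuous_intros)
  ultimately show ?thesis
    by (subst continuous_on_cong[OF refl]) auto
qed

lemma bounded_bilinear_matrix_vector: "bounded_bilinear ((*v) :: real^'n^'m \<Rightarrow> _)"
  unfolding bilinear_conv_bounded_bilinear[symmetric] bilinear_def
  by (auto intro!: linearI simp: matrix_vector_right_distrib matrix_vector_mult_add_rdistrib
      scaleR_matrix_vector_assoc matrix_vector_mult_scaleR)

lemma (in bounded_bilinear) bounded_image:
  assumes "bounded (f ` S)" "bounded (g ` S)"
  shows "bounded ((\<lambda>x. prod (f x) (g x)) ` S)"
proof -
  obtain B C where B: "\<And>x. x \<in> S \<Longrightarrow> norm (f x) \<le> B" and C: "\<And>x. x \<in> S \<Longrightarrow> norm (g x) \<le> C"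
    using assms by (auto simp: bounded_iff)
  obtain K where K: "0 < K" "\<And>a b. norm (prod a b) \<le> norm a * norm b * K"
    using pos_bounded by blast
  have "norm (prod (f x) (g x)) \<le> B * C * K" if "x \<in> S" for x
  proof -
    have "norm (prod (f x) (g x)) \<le> norm (f x) * norm (g x) * K"
      by (rule K)
    also have "\<dots> \<le> B * C * K"
      using K(1) B[OF that] C[OF that] by (intro mult_right_mono mult_mono') auto
    finally show ?thesis .
  qed
  then show ?thesis by (auto simp: bounded_iff)
qed

text \<open>On an open cell the Jacobian coincides with the field \<open>G\<close>, which is
  continuous with positive determinant on the whole compact cell. Hence \<open>F\<close> of it is
  bounded there without any assumed lower bound on the determinant. \<open>F\<close> is kept general
  to serve both Piola factors: \<open>det A *\<^sub>R matrix_inv A\<close> for the pullback and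
  \<open>(1 / det A) *\<^sub>R A\<close> for the push-forward.\<close>

lemma mesh_map_regular:
  assumes \<Omega>: "polyhedral_domain \<Omega>r" and T: "conforming_triangulation \<Omega>r Tr" and X: "mesh_map \<Omega>r Tr \<Omega> T X"
  shows "y \<in> mesh_interior \<Omega>r Tr \<Longrightarrow> (X has_derivative (\<lambda>h. jacobian X (at y) *v h)) (at y)"
    and "y \<in> mesh_interior \<Omega>r Tr \<Longrightarrow> 0 < det (jacobian X (at y))"
    and "continuous_on {A. 0 < det A} F \<Longrightarrow>
      continuous_on (mesh_interior \<Omega>r Tr) (\<lambda>y. F (jacobian X (at y)))"
    and "continuous_on {A. 0 < det A} F \<Longrightarrow>
      bounded ((\<lambda>y. F (jacobian X (at y))) ` mesh_interior \<Omega>r Tr)"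
proof -
  have "\<forall>K\<in>Tr. \<exists>G. continuous_on K G \<and>
      (\<forall>y\<in>K. (X has_derivative (\<lambda>h. G y *v h)) (at y within K) \<and> 0 < det (G y))"
    using X by (simp add: mesh_map_def)
  from bchoice[OF this]
  obtain G where G': "\<forall>K\<in>Tr. continuous_on K (G K) \<and>
      (\<forall>y\<in>K. (X has_derivative (\<lambda>h. G K y *v h)) (at y within K) \<and> 0 < det (G K y))"
    by blast
  have G: "\<And>K. K \<in> Tr \<Longrightarrow> continuous_on K (G K)"
    "\<And>K y. \<lbrakk>K \<in> Tr; y \<in> K\<rbrakk> \<Longrightarrow> (X has_derivative (\<lambda>h. G K y *v h)) (at y within K)"
    "\<And>K y. \<lbrakk>K \<in> Tr; y \<in> K\<rbrakk> \<Longrightarrow> 0 < det (G K y)"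
    using G' by blast+
  \<comment> \<open>At interior points of a cell the derivative within the cell is the full
    derivative, so \<open>jacobian X (at y)\<close> is forced to be \<open>G K y\<close>.\<close>
  have der: "(X has_derivative (\<lambda>h. G K y *v h)) (at y)" if "K \<in> Tr" "y \<in> interior K" for K y
    using G(2)[OF that(1) subsetD[OF interior_subset that(2)]] by (simp only: at_within_interior[OF that(2)])
  have jac: "jacobian X (at y) = G K y" if "K \<in> Tr" "y \<in> interior K" for K y
    by (simp add: jacobian_def frechet_derivative_at[OF der[OF that], symmetric])
  show "(X has_derivative (\<lambda>h. jacobian X (at y) *v h)) (at y)" "0 < det (jacobian X (at y))"
    if y: "y \<in> mesh_interior \<Omega>r Tr"
  proof -
    obtain K where K: "K \<in> Tr" "y \<in> interior K"
      using y by (auto simp: mesh_interior_def)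
    show "(X has_derivative (\<lambda>h. jacobian X (at y) *v h)) (at y)" "0 < det (jacobian X (at y))"
      unfolding jac[OF K] by (rule der[OF K], rule G(3)[OF K(1) subsetD[OF interior_subset K(2)]])
  qed
  assume F: "continuous_on {A. 0 < det A} F"
  have FG: "continuous_on K (\<lambda>y. F (G K y))" if "K \<in> Tr" for K
    using G(3)[OF that] by (intro continuous_on_compose2[OF F G(1)[OF that]]) auto
  have "continuous_on (interior K) (\<lambda>y. F (jacobian X (at y)))" if "K \<in> Tr" for K
    using continuous_on_subset[OF FG[OF that] interior_subset]
    by (rule continuous_on_eq) (simp add: jac[OF that])
  then have "continuous_on (\<Union>(interior ` Tr)) (\<lambda>y. F (jacobian X (at y)))"
    by (intro continuous_on_open_Union) auto
  then show "continuous_on (mesh_interior \<Omega>r Tr) (\<lambda>y. F (jacobian X (at y)))"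
    by (rule continuous_on_subset) (auto simp: mesh_interior_def)
  have "bounded (\<Union>K\<in>Tr. (\<lambda>y. F (G K y)) ` K)"
    using T FG triangulation_cell(1)[OF T]
    by (intro bounded_UN)
       (auto intro!: compact_imp_bounded compact_continuous_image simp: conforming_triangulation_def triangulation_def)
  then show "bounded ((\<lambda>y. F (jacobian X (at y))) ` mesh_interior \<Omega>r Tr)"
  proof (rule bounded_subset)
    show "(\<lambda>y. F (jacobian X (at y))) ` mesh_interior \<Omega>r Tr \<subseteq> (\<Union>K\<in>Tr. (\<lambda>y. F (G K y)) ` K)"
    proof
      fix z assume "z \<in> (\<lambda>y. F (jacobian X (at y))) ` mesh_interior \<Omega>r Tr"
      then obtain K y where K: "K \<in> Tr" "y \<in> interior K" and z: "z = F (jacobian X (at y))"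
        by (auto simp: mesh_interior_def)
      show "z \<in> (\<Union>K\<in>Tr. (\<lambda>y. F (G K y)) ` K)"
        unfolding z jac[OF K] by (intro UN_I[OF K(1)] imageI subsetD[OF interior_subset K(2)])
    qed
  qed
qed

text \<open>Openness of the images comes from invariance of domain, \<open>X\<close> being
  continuous and injective. So the image of an open cell is an open subset of a cell of
  \<open>T\<close> and lies in its interior. For null sets, differentiability is used cell by cell,
  since \<open>X\<close> may have kinks across faces.\<close>

lemma mesh_map_image:
  assumes \<Omega>: "polyhedral_domain \<Omega>r" and T: "conforming_triangulation \<Omega>r Tr" and X: "mesh_map \<Omega>r Tr \<Omega> T X"
  shows "inj_on X (mesh_interior \<Omega>r Tr)" "continuous_on (mesh_interior \<Omega>r Tr) X"
    and "open (X ` mesh_interior \<Omega>r Tr)"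
    and "X ` mesh_interior \<Omega>r Tr \<subseteq> mesh_interior \<Omega> T"
    and "\<lbrakk>N \<subseteq> \<Omega>r; negligible N\<rbrakk> \<Longrightarrow> negligible (X ` N)"
    and "negligible (\<Omega> - X ` mesh_interior \<Omega>r Tr)"
proof -
  let ?U = "mesh_interior \<Omega>r Tr"
  have U: "?U \<subseteq> closure \<Omega>r"
    using mesh_interior_subset closure_subset by blast
  have X': "continuous_on (closure \<Omega>r) X" "inj_on X (closure \<Omega>r)" "X ` \<Omega>r = \<Omega>" "(`) X ` Tr = T"
    using X by (auto simp: mesh_map_def)
  show inj: "inj_on X ?U" and cont: "continuous_on ?U X"
    using X' U by (auto intro: inj_on_subset continuous_on_subset)
  show "open (X ` ?U)"
    by (rule invariance_of_domain[OF cont open_mesh_interior[OF \<Omega>] inj])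
  have "X ` interior K \<subseteq> interior (X ` K)" if "K \<in> Tr" for K
  proof (rule interior_maximal[OF image_mono[OF interior_subset]])
    have "interior K \<subseteq> closure \<Omega>r"
      using triangulation_cell(4)[OF T that] interior_subset by blast
    then show "open (X ` interior K)"
      using X' by (intro invariance_of_domain open_interior) (auto intro: inj_on_subset continuous_on_subset)
  qed
  then show "X ` ?U \<subseteq> mesh_interior \<Omega> T"
    using X'(3,4) unfolding mesh_interior_def by blast
  show neg: "negligible (X ` N)" if N: "N \<subseteq> \<Omega>r" "negligible N" for N
  proof -
    have "finite Tr" "\<Omega>r \<subseteq> \<Union>Tr"
      using T closure_subset[of \<Omega>r] by (auto simp: conforming_triangulation_def triangulation_def)
    have "negligible (X ` (N \<inter> K))" if "K \<in> Tr" for K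
    proof (rule negligible_differentiable_image_negligible)
      show "negligible (N \<inter> K)"
        using N(2) by (rule negligible_subset) auto
      have "X differentiable_on K"
        using X that by (auto simp: mesh_map_def differentiable_on_def intro: differentiableI)
      then show "X differentiable_on N \<inter> K"
        by (rule differentiable_on_subset) auto
    qed auto
    then have "negligible (\<Union>K\<in>Tr. X ` (N \<inter> K))"
      using \<open>finite Tr\<close> by (intro negligible_Union) auto
    then show ?thesis
      by (rule negligible_subset) (use N \<open>\<Omega>r \<subseteq> \<Union>Tr\<close> in blast)
  qed
  have "negligible (X ` (\<Omega>r - ?U))"
    by (intro neg negligible_skeleton[OF T]) auto
  then show "negligible (\<Omega> - X ` ?U)"
    by (rule negligible_subset) (use X'(3) in blast)
qed

text \<open>\<open>X\<close> takes open reference cells into open cells of the mesh that carries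
  \<open>u\<close>, where \<open>u\<close> is continuous. Velocities from different meshes thus
  become continuous on the same open reference cells, and so does their extrapolation.\<close>

lemma piola_pullback_regular:
  assumes \<Omega>: "polyhedral_domain \<Omega>r" and T: "conforming_triangulation \<Omega>r Tr" and X: "mesh_map \<Omega>r Tr \<Omega> T X"
    and u: "continuous_on (mesh_interior \<Omega> T) u" "bounded (u ` \<Omega>)"
  shows "continuous_on (mesh_interior \<Omega>r Tr) (piola_pullback X u)"
    "bounded (piola_pullback X u ` mesh_interior \<Omega>r Tr)"
proof -
  let ?F = "\<lambda>A::real^'a^'a. det A *\<^sub>R matrix_inv A"
  note im = mesh_map_image[OF \<Omega> T X]
  have F: "continuous_on {A. 0 < det A} ?F"
    by (intro continuous_intros continuous_on_matrix_inv continuous_on_det_nth)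
  have p: "piola_pullback X u = (\<lambda>y. ?F (jacobian X (at y)) *v u (X y))"
    by (simp add: fun_eq_iff piola_pullback_def scaleR_matrix_vector_assoc)
  show "continuous_on (mesh_interior \<Omega>r Tr) (piola_pullback X u)"
    unfolding p using im
    by (intro bounded_bilinear.continuous_on[OF bounded_bilinear_matrix_vector] mesh_map_regular(3)[OF \<Omega> T X F]
        continuous_on_compose2[OF u(1)])
  have "X ` mesh_interior \<Omega>r Tr \<subseteq> \<Omega>"
    using im(4) mesh_interior_subset by blast
  then have "bounded ((\<lambda>y. u (X y)) ` mesh_interior \<Omega>r Tr)"
    by (intro bounded_subset[OF u(2)]) auto
  then show "bounded (piola_pullback X u ` mesh_interior \<Omega>r Tr)"
    unfolding p
    by (intro bounded_bilinear.bounded_image[OF bounded_bilinear_matrix_vector] mesh_map_regular(4)[OF \<Omega> T X F])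
qed

lemma lebesgue_integral_conull:
  fixes f :: "'a::euclidean_space \<Rightarrow> real"
  assumes \<Omega>: "\<Omega> \<in> sets lebesgue" and U: "U \<in> sets lebesgue" "U \<subseteq> \<Omega>" "negligible (\<Omega> - U)"
    and f: "integrable (lebesgue_on \<Omega>) f"
  shows "integrable (lebesgue_on U) f" "integral\<^sup>L (lebesgue_on U) f = integral\<^sup>L (lebesgue_on \<Omega>) f"
proof -
  have \<Omega>f: "integrable lebesgue (\<lambda>x. indicator \<Omega> x *\<^sub>R f x)"
    using f \<Omega> by (simp add: integrable_restrict_space)
  have "integrable lebesgue (\<lambda>x. indicator U x *\<^sub>R (indicator \<Omega> x *\<^sub>R f x))"
    by (rule integrable_mult_indicator[OF U(1) \<Omega>f])
  moreover have "(\<lambda>x. indicat_real U x *\<^sub>R (indicat_real \<Omega> x *\<^sub>R f x)) = (\<lambda>x. indicator U x *\<^sub>R f x)"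
    using U(2) by (auto simp: fun_eq_iff indicator_def)
  ultimately have Uf: "integrable lebesgue (\<lambda>x. indicator U x *\<^sub>R f x)"
    by (simp only:)
  then show "integrable (lebesgue_on U) f"
    using U(1) by (simp add: integrable_restrict_space)
  have "AE x in lebesgue. x \<notin> \<Omega> - U"
    using U(3) by (intro AE_not_in) (simp add: negligible_iff_null_sets)
  then have "AE x in lebesgue. indicator U x *\<^sub>R f x = indicator \<Omega> x *\<^sub>R f x"
    using U(2) by (auto simp: indicator_def elim!: eventually_mono)
  then have "integral\<^sup>L lebesgue (\<lambda>x. indicator U x *\<^sub>R f x) = integral\<^sup>L lebesgue (\<lambda>x. indicator \<Omega> x *\<^sub>R f x)"
    using Uf \<Omega>f by (intro integral_cong_AE) auto
  then show "integral\<^sup>L (lebesgue_on U) f = integral\<^sup>L (lebesgue_on \<Omega>) f"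
    using U(1) \<Omega> by (simp add: integral_restrict_space)
qed

text \<open>The chain rule in the form that the pulled-back gradient is the transpose of
  \<open>A\<close> applied to \<open>grad \<eta> (X y)\<close>, with the transpose moved to the
  other factor.\<close>

lemma grad_pullback:
  assumes U: "open U" "y \<in> U" and eq: "\<And>z. z \<in> U \<Longrightarrow> \<eta>r z = \<eta> (X z)"
    and X: "(X has_derivative (\<lambda>h. A *v h)) (at y)" and \<eta>: "\<eta> differentiable (at (X y))"
  shows "grad \<eta>r y \<bullet> h = grad \<eta> (X y) \<bullet> (A *v h)"
proof -
  have "((\<lambda>z. \<eta> (X z)) has_derivative (\<lambda>h. grad \<eta> (X y) \<bullet> (A *v h))) (at y)"
    by (rule has_derivative_compose[OF X has_derivative_grad[OF \<eta>]])
  then have d: "(\<eta>r has_derivative (\<lambda>h. grad \<eta> (X y) \<bullet> (A *v h))) (at y)"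
    by (rule has_derivative_transform_within_open[OF _ U]) (simp add: eq)
  from has_derivative_unique[OF has_derivative_grad[OF differentiableI[OF d]] d] show ?thesis
    by (rule fun_cong)
qed

text \<open>The Piola map is dual to the pullback of gradients, so the current-space pairing becomes the
  reference pairing of the corrected field.\<close>

lemma L2_inner_piola:
  assumes \<Omega>: "polyhedral_domain \<Omega>" and T: "conforming_triangulation \<Omega> T"
    and \<Omega>r: "polyhedral_domain \<Omega>r" and Tr: "conforming_triangulation \<Omega>r Tr"
    and X: "mesh_map \<Omega>r Tr \<Omega> T X"
    and w: "continuous_on (mesh_interior \<Omega>r Tr) w" "bounded (w ` mesh_interior \<Omega>r Tr)"
    and uc: "AE y in lebesgue_on \<Omega>r. uc (X y) = (1 / det (jacobian X (at y))) *\<^sub>R (jacobian X (at y) *v w y)"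
  shows "ess_bounded \<Omega> uc"
    and "\<lbrakk>\<eta> \<in> fe_functions \<Omega> T; \<eta>r \<in> fe_functions \<Omega>r Tr; \<forall>y\<in>\<Omega>r. \<eta>r y = \<eta> (X y)\<rbrakk> \<Longrightarrow>
      L2_inner \<Omega> uc (grad \<eta>) = L2_inner \<Omega>r w (grad \<eta>r)"
proof -
  define U where "U = mesh_interior \<Omega>r Tr"
  \<comment> \<open>The prescribed values of \<open>uc\<close> after composition with
    \<open>X\<close>. Unlike \<open>uc\<close>, this field is continuous and bounded on the open
    reference cells.\<close>
  define h where "h y = ((1 / det (jacobian X (at y))) *\<^sub>R jacobian X (at y)) *v w y" for y
  note im = mesh_map_image[OF \<Omega>r Tr X, folded U_def]
  note reg = mesh_map_regular[OF \<Omega>r Tr X, folded U_def]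
  note meas = polyhedral_domain_sets[OF \<Omega>] polyhedral_domain_sets[OF \<Omega>r]
  have U: "open U" "U \<subseteq> \<Omega>r" "negligible (\<Omega>r - U)" "U \<in> sets lebesgue"
    using open_mesh_interior[OF \<Omega>r] negligible_skeleton[OF Tr] by (auto simp: U_def mesh_interior_subset)
  have XU: "X ` U \<subseteq> \<Omega>" "X ` U \<in> sets lebesgue"
    using im(3,4) mesh_interior_subset[of \<Omega> T] by auto
  have F: "continuous_on {A. 0 < det A} (\<lambda>A::real^'a^'a. (1 / det A) *\<^sub>R A)"
    by (intro continuous_intros continuous_on_det_nth) auto
  have hc: "continuous_on U h"
    unfolding h_def using w(1)
    by (intro bounded_bilinear.continuous_on[OF bounded_bilinear_matrix_vector] reg(3)[OF F]) (simp add: U_def)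
  have hb: "bounded (h ` U)"
    unfolding h_def using w(2)
    by (intro bounded_bilinear.bounded_image[OF bounded_bilinear_matrix_vector] reg(4)[OF F]) (simp add: U_def)
  \<comment> \<open>A continuous inverse of \<open>X\<close> on the open cells; \<open>h\<close>
    composed with \<open>g\<close> is a regular representative of \<open>uc\<close> on
    \<open>\<Omega>\<close>.\<close>
  obtain g where g: "homeomorphism U (X ` U) X g"
    using invariance_of_domain_homeomorphism[OF U(1) im(2) order_refl im(1)] by blast
  have gX: "g (X y) = y" if "y \<in> U" for y
    using g that by (simp add: homeomorphism_def)
  have hg: "continuous_on (X ` U) (\<lambda>x. h (g x))"
    using g hc by (intro continuous_on_compose2[OF hc]) (auto simp: homeomorphism_def)
  have "(\<lambda>x. h (g x)) ` X ` U = h ` U"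
    using gX by force
  then have ucs: "ess_bounded \<Omega> (\<lambda>x. h (g x))"
    using hg hb by (intro ess_bounded_continuous_on[OF meas(1) im(3) im(6)]) auto
  have N: "negligible {y \<in> \<Omega>r. uc (X y) \<noteq> h y}"
    using uc AE_lebesgue_on_iff[OF meas(2)] by (simp add: h_def scaleR_matrix_vector_assoc)
  \<comment> \<open>The representative can differ from \<open>uc\<close> only on the image of the
    exceptional reference set or off the image of the open cells.\<close>
  have "negligible (X ` {y \<in> \<Omega>r. uc (X y) \<noteq> h y} \<union> (\<Omega> - X ` U))"
    by (intro negligible_Un im(5) im(6) N) auto
  then have "negligible {x \<in> \<Omega>. h (g x) \<noteq> uc x}"
    by (rule negligible_subset) (use gX U(2) in auto)
  then have ae: "AE x in lebesgue_on \<Omega>. h (g x) = uc x"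
    using AE_lebesgue_on_iff[OF meas(1)] by blast
  show uc': "ess_bounded \<Omega> uc"
    by (rule ess_bounded_AE[OF ucs meas(1) ae])
  assume \<eta>: "\<eta> \<in> fe_functions \<Omega> T" and \<eta>r: "\<eta>r \<in> fe_functions \<Omega>r Tr"
    and eq: "\<forall>y\<in>\<Omega>r. \<eta>r y = \<eta> (X y)"
  note g\<eta> = fe_function_ess_bounded(2)[OF \<Omega> T \<eta>] and g\<eta>r = fe_function_ess_bounded(2)[OF \<Omega>r Tr \<eta>r]
  let ?f = "\<lambda>x. h (g x) \<bullet> grad \<eta> x"
  have int: "integrable (lebesgue_on \<Omega>) ?f"
    by (intro integrable_inner_ess_bounded ess_bounded_integrable ucs g\<eta> polyhedral_domain_lmeasurable \<Omega>)
  have wb: "ess_bounded \<Omega>r w"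
    using w by (intro mesh_regular_ess_bounded[OF \<Omega>r Tr])
  have intr: "integrable (lebesgue_on \<Omega>r) (\<lambda>y. w y \<bullet> grad \<eta>r y)"
    by (intro integrable_inner_ess_bounded ess_bounded_integrable wb g\<eta>r polyhedral_domain_lmeasurable \<Omega>r)
  have "L2_inner \<Omega> uc (grad \<eta>) = L2_inner \<Omega> (\<lambda>x. h (g x)) (grad \<eta>)"
    using ae by (intro L2_inner_cong_AE[OF meas(1) _ uc' ucs g\<eta>]) (auto elim: eventually_mono)
  also have "\<dots> = integral\<^sup>L (lebesgue_on (X ` U)) ?f"
    unfolding L2_inner_eq[OF meas(1)]
    by (rule lebesgue_integral_conull(2)[OF meas(1) XU(2,1) im(6) int, symmetric])
  also have "\<dots> = integral\<^sup>L (lebesgue_on U) (\<lambda>y. \<bar>det (matrix ((*v) (jacobian X (at y))))\<bar> * ?f (X y))"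
    using has_integral_change_of_variables[OF U(4) has_derivative_at_withinI[OF reg(1)] im(1)
        lebesgue_integral_conull(1)[OF meas(1) XU(2,1) im(6) int]]
    by (simp add: has_bochner_integral_iff)
  also have "\<dots> = integral\<^sup>L (lebesgue_on U) (\<lambda>y. w y \<bullet> grad \<eta>r y)"
  proof (intro Bochner_Integration.integral_cong refl)
    fix y assume "y \<in> space (lebesgue_on U)"
    then have y: "y \<in> U" by simp
    let ?J = "jacobian X (at y)"
    have "X y \<in> mesh_interior \<Omega> T"
      using y im(4) by blast
    then have d: "\<eta> differentiable (at (X y))"
      by (rule fe_function_differentiable[OF \<eta>])
    have "\<bar>det (matrix ((*v) ?J))\<bar> * ?f (X y) = grad \<eta> (X y) \<bullet> (?J *v w y)"
      using reg(2)[OF y]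
      by (simp add: gX[OF y] h_def flip: scaleR_matrix_vector_assoc) (simp add: inner_commute)
    also have "\<dots> = grad \<eta>r y \<bullet> w y"
      using eq U(2) by (intro grad_pullback[OF U(1) y _ reg(1)[OF y] d, symmetric]) auto
    finally show "\<bar>det (matrix ((*v) ?J))\<bar> * ?f (X y) = w y \<bullet> grad \<eta>r y"
      by (simp add: inner_commute)
  qed
  also have "\<dots> = L2_inner \<Omega>r w (grad \<eta>r)"
    unfolding L2_inner_eq[OF meas(2)]
    by (rule lebesgue_integral_conull(2)[OF meas(2) U(4,2,3) intr])
  finally show "L2_inner \<Omega> uc (grad \<eta>) = L2_inner \<Omega>r w (grad \<eta>r)" .
qed

lemma fixed_topology_carrier_admissible:
  assumes \<Omega>: "polyhedral_domain \<Omega>" and T: "\<And>l. conforming_triangulation \<Omega> (T l)"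
    and S: "fe_space \<Omega> (T (Suc n)) (S (Suc n))" and one: "(\<lambda>x. 1) \<in> S (Suc n)"
    and V: "\<And>l. vector_fe_space \<Omega> (T l) (V l)" and u: "\<And>l. u l \<in> V l"
    and k: "admissible_order k n"
    and uc: "fixed_topology_carrier \<Omega> T S k n u uc"
  shows "admissible_carrier \<Omega> (S (Suc n)) uc"
proof -
  obtain \<Omega>r Tr X Sr lam where \<Omega>r: "polyhedral_domain \<Omega>r" and Tr: "conforming_triangulation \<Omega>r Tr"
    and X: "\<And>l. l \<in> {n, Suc n} \<union> (if k = 2 then {n - 1} else {}) \<Longrightarrow> mesh_map \<Omega>r Tr \<Omega> (T l) (X l)"
    and Sr: "fe_space \<Omega>r Tr Sr"
    and pull: "\<And>\<eta>. \<eta> \<in> S (Suc n) \<Longrightarrow> \<exists>\<eta>r\<in>Sr. \<forall>y\<in>\<Omega>r. \<eta>r y = \<eta> (X (Suc n) y)"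
    and lam: "lam \<in> zero_mean \<Omega>r Sr"
    and orth: "\<And>\<eta>r. \<eta>r \<in> zero_mean \<Omega>r Sr \<Longrightarrow>
           L2_inner \<Omega>r (grad lam) (grad \<eta>r)
           = L2_inner \<Omega>r (extrapolation k n (\<lambda>l. piola_pullback (X l) (u l))) (grad \<eta>r)"
    and uc_eq: "AE y in lebesgue_on \<Omega>r.
           uc (X (Suc n) y) =
             (1 / det (jacobian (X (Suc n)) (at y))) *\<^sub>R
             (jacobian (X (Suc n)) (at y) *v
                (extrapolation k n (\<lambda>l. piola_pullback (X l) (u l)) y - grad lam y))"
    using uc unfolding fixed_topology_carrier_def by blast
  define p where "p l = piola_pullback (X l) (u l)" for l
  define E where "E = extrapolation k n p"
  let ?U = "mesh_interior \<Omega>r Tr"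
  note measr = polyhedral_domain_lmeasurable[OF \<Omega>r] polyhedral_domain_sets[OF \<Omega>r]
  have p: "continuous_on ?U (p l)" "bounded (p l ` ?U)" if "l = n \<or> k = 2 \<and> l = n - 1" for l
  proof -
    have "mesh_map \<Omega>r Tr \<Omega> (T l) (X l)"
      using that by (intro X) auto
    from piola_pullback_regular[OF \<Omega>r Tr this vector_fe_function_regular[OF T V u]]
    show "continuous_on ?U (p l)" "bounded (p l ` ?U)"
      by (simp_all add: p_def)
  qed
  \<comment> \<open>\<open>X l\<close> is known to be a mesh map only at the levels that the order
    \<open>k\<close> uses, so regularity of the extrapolation is argued by cases on \<open>k\<close>
    and not for all levels at once.\<close>
  have E: "continuous_on ?U E \<and> bounded (E ` ?U)"
  proof (cases "k = 1")
    case True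
    then show ?thesis
      using p[of n] by (simp add: E_def extrapolation_def[abs_def])
  next
    case False
    then have "k = 2"
      using k by (simp add: admissible_order_def)
    have "bounded ((\<lambda>y. 2 *\<^sub>R p n y) ` ?U)"
      using bounded_scaling[of "p n ` ?U" 2] p[of n] by (simp add: image_image)
    then show ?thesis
      using p[of n] p[of "n - 1"] \<open>k = 2\<close>
      by (auto simp: E_def extrapolation_def[abs_def] intro!: continuous_intros bounded_minus_comp)
  qed
  have SrF: "v \<in> fe_functions \<Omega>r Tr" if "v \<in> Sr" for v
    using Sr that by (auto simp: fe_space_def)
  have "lam \<in> fe_functions \<Omega>r Tr"
    using lam SrF by (simp add: zero_mean_def)
  note glam = fe_function_regular[OF Tr this] fe_function_ess_bounded[OF \<Omega>r Tr this]
  let ?w = "\<lambda>y. E y - grad lam y"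
  have w: "continuous_on ?U ?w" "bounded (?w ` ?U)"
    using E glam by (auto intro!: continuous_intros bounded_minus_comp)
  have Eb: "ess_bounded \<Omega>r E"
    using E by (intro mesh_regular_ess_bounded[OF \<Omega>r Tr]) auto
  \<comment> \<open>The constant 1 of the current space, pulled back to the reference
    domain.\<close>
  obtain e where e: "e \<in> Sr" "\<And>y. y \<in> \<Omega>r \<Longrightarrow> e y = 1"
    using pull[OF one] by auto
  have "L2_inner \<Omega>r ?w (grad \<eta>r) = 0" if "\<eta>r \<in> zero_mean \<Omega>r Sr" for \<eta>r
  proof -
    have "ess_bounded \<Omega>r (grad \<eta>r)"
      using that SrF fe_function_ess_bounded(2)[OF \<Omega>r Tr] by (simp add: zero_mean_def)
    then show ?thesis
      using orth[OF that] measr(1) Eb glam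
      by (simp add: L2_inner_diff ess_bounded_integrable E_def p_def[abs_def])
  qed
  then have orth': "L2_inner \<Omega>r ?w (grad \<eta>r) = 0" if "\<eta>r \<in> Sr" for \<eta>r
    using orthogonal_grad_of_zero_mean[OF \<Omega>r Tr Sr e] that by blast
  have XS: "mesh_map \<Omega>r Tr \<Omega> (T (Suc n)) (X (Suc n))"
    by (rule X) simp
  note piola = L2_inner_piola[OF \<Omega> T \<Omega>r Tr XS w uc_eq[folded p_def E_def]]
  have "L2_inner \<Omega> uc (grad \<eta>) = 0" if \<eta>: "\<eta> \<in> S (Suc n)" for \<eta>
  proof -
    obtain \<eta>r where \<eta>r: "\<eta>r \<in> Sr" "\<forall>y\<in>\<Omega>r. \<eta>r y = \<eta> (X (Suc n) y)"
      using pull[OF \<eta>] by blast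
    have "\<eta> \<in> fe_functions \<Omega> (T (Suc n))"
      using S \<eta> by (auto simp: fe_space_def)
    from piola(2)[OF this SrF[OF \<eta>r(1)] \<eta>r(2)] show ?thesis
      using orth'[OF \<eta>r(1)] by simp
  qed
  then show ?thesis
    using ess_bounded_L2[OF polyhedral_domain_lmeasurable[OF \<Omega>] piola(1)] by (simp add: admissible_carrier_def)
qed

section \<open>Conservation\<close>

text \<open>An essential bound on the phase confines its values to a ball, and \<open>m\<close> is
  bounded on balls; \<open>m\<close> may be discontinuous.\<close>

lemma ess_bounded_compose:
  fixes m :: "real \<Rightarrow> real"
  assumes f: "ess_bounded \<Omega> f" and m: "m \<in> borel_measurable borel" "\<And>B. bounded B \<Longrightarrow> bounded (m ` B)"
  shows "ess_bounded \<Omega> (\<lambda>x. m (f x))"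
proof -
  obtain B where B: "AE x in lebesgue_on \<Omega>. norm (f x) \<le> B"
    using f by (auto simp: ess_bounded_def)
  obtain C where C: "\<And>t. t \<in> cball 0 B \<Longrightarrow> norm (m t) \<le> C"
    using m(2)[OF bounded_cball[of 0 B]] unfolding bounded_iff by blast
  have "AE x in lebesgue_on \<Omega>. norm (m (f x)) \<le> C"
    using B by eventually_elim (rule C, simp)
  moreover have "(\<lambda>x. m (f x)) \<in> borel_measurable (lebesgue_on \<Omega>)"
    using f m(1) by (auto simp: ess_bounded_def)
  ultimately show ?thesis
    by (auto simp: ess_bounded_def)
qed

text \<open>The scalar factor is moved onto \<open>g\<close>, so that a single essentially bounded
  function multiplies \<open>f\<close>.\<close>

lemma integrable_scaleR_inner_ess_bounded:
  assumes "integrable (lebesgue_on \<Omega>) f" "ess_bounded \<Omega> a" "ess_bounded \<Omega> g"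
  shows "integrable (lebesgue_on \<Omega>) (\<lambda>x. (a x *\<^sub>R f x) \<bullet> g x)"
  using integrable_inner_ess_bounded[OF assms(1) ess_bounded_scaleR[OF assms(2,3)]] by simp

text \<open>Inserting the affine mixture density splits the flux into three terms. Of all factors
  only \<open>uc\<close> may be unbounded; it is integrable and occurs at most once in each term, so
  each integral exists and linearity applies.\<close>

lemma L2_inner_mass_flux:
  assumes \<Omega>: "\<Omega> \<in> lmeasurable" and uc: "integrable (lebesgue_on \<Omega>) uc"
    and E: "ess_bounded \<Omega> (extrapolation k n \<phi>)" and mE: "ess_bounded \<Omega> (\<lambda>x. m (extrapolation k n \<phi> x))"
    and \<mu>: "ess_bounded \<Omega> (grad \<mu>)" and g: "ess_bounded \<Omega> g"
  shows "L2_inner \<Omega> (mass_flux \<rho>0 \<rho>\<phi> Pe m k n \<phi> \<mu> uc) g =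
    \<rho>0 * L2_inner \<Omega> uc g + \<rho>\<phi> * L2_inner \<Omega> (\<lambda>x. extrapolation k n \<phi> x *\<^sub>R uc x) g
    - \<rho>\<phi> / Pe * L2_inner \<Omega> (\<lambda>x. m (extrapolation k n \<phi> x) *\<^sub>R grad \<mu> x) g"
proof -
  let ?a = "\<lambda>x. uc x \<bullet> g x" and ?b = "\<lambda>x. (extrapolation k n \<phi> x *\<^sub>R uc x) \<bullet> g x"
    and ?d = "\<lambda>x. (m (extrapolation k n \<phi> x) *\<^sub>R grad \<mu> x) \<bullet> g x"
  have int: "integrable (lebesgue_on \<Omega>) ?a" "integrable (lebesgue_on \<Omega>) ?b" "integrable (lebesgue_on \<Omega>) ?d"
    by (rule integrable_inner_ess_bounded[OF uc g] integrable_scaleR_inner_ess_bounded[OF uc E g]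
        integrable_scaleR_inner_ess_bounded[OF ess_bounded_integrable[OF \<Omega> \<mu>] mE g])+
  have lin: "integral\<^sup>L M (\<lambda>x. \<alpha> * a x + \<beta> * b x - \<gamma> * d x) =
      \<alpha> * integral\<^sup>L M a + \<beta> * integral\<^sup>L M b - \<gamma> * integral\<^sup>L M d"
    if "integrable M a" "integrable M b" "integrable M d"
    for M :: "(real^'a) measure" and a b d :: "real^'a \<Rightarrow> real" and \<alpha> \<beta> \<gamma> :: real
    using that by simp
  have "(\<lambda>x. mass_flux \<rho>0 \<rho>\<phi> Pe m k n \<phi> \<mu> uc x \<bullet> g x) = (\<lambda>x. \<rho>0 * ?a x + \<rho>\<phi> * ?b x - \<rho>\<phi> / Pe * ?d x)"
    by (simp add: fun_eq_iff mass_flux_def mixture_density_def inner_diff_left inner_add_left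
        scaleR_add_left algebra_simps)
  then have "L2_inner \<Omega> (mass_flux \<rho>0 \<rho>\<phi> Pe m k n \<phi> \<mu> uc) g =
      integral\<^sup>L (lebesgue_on \<Omega>) (\<lambda>x. \<rho>0 * ?a x + \<rho>\<phi> * ?b x - \<rho>\<phi> / Pe * ?d x)"
    by (simp only: L2_inner_eq[OF fmeasurableD[OF \<Omega>]])
  also have "\<dots> = \<rho>0 * integral\<^sup>L (lebesgue_on \<Omega>) ?a + \<rho>\<phi> * integral\<^sup>L (lebesgue_on \<Omega>) ?b
      - \<rho>\<phi> / Pe * integral\<^sup>L (lebesgue_on \<Omega>) ?d"
    by (rule lin[OF int])
  finally show ?thesis
    by (simp only: L2_inner_eq[OF fmeasurableD[OF \<Omega>]])
qed

theorem theorem4p1: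
  fixes \<Omega> :: "(real^'n) set"
    and T :: "nat \<Rightarrow> (real^'n) set set"
    and S :: "nat \<Rightarrow> (real^'n \<Rightarrow> real) set"
    and V :: "nat \<Rightarrow> (real^'n \<Rightarrow> real^'n) set"
    and \<phi> :: "nat \<Rightarrow> real^'n \<Rightarrow> real"
    and u :: "nat \<Rightarrow> real^'n \<Rightarrow> real^'n"
    and m :: "real \<Rightarrow> real"
    and \<tau> Cn Pe s \<rho>0 \<rho>\<phi> :: real
  assumes dim: "CARD('n) \<in> {2, 3}"
    and domain: "polyhedral_domain \<Omega>"
    and mesh: "\<And>l. conforming_triangulation \<Omega> (T l)"
    and scalar_space: "\<And>l. fe_space \<Omega> (T l) (S l)"
    and one_in_space: "\<And>l. (\<lambda>x. 1) \<in> S l"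
    and vector_space: "\<And>l. vector_fe_space \<Omega> (T l) (V l)"
    and params: "0 < \<tau>" "0 < Cn" "0 < Pe" "0 < s"
    and mobility: "\<And>r. 0 \<le> m r" "m \<in> borel_measurable borel" "\<And>B. bounded B \<Longrightarrow> bounded (m ` B)"
    and phase: "\<And>l. \<phi> l \<in> S l"
    and velocity: "\<And>l. u l \<in> V l"
  shows
    "(\<forall>k n uc. admissible_order k n \<and>
        (topology_changing_carrier \<Omega> (S (Suc n)) (extrapolation k n u) uc
         \<or> fixed_topology_carrier \<Omega> T S k n u uc)
        \<longrightarrow> admissible_carrier \<Omega> (S (Suc n)) uc)
     \<and>
     (\<forall>k n \<phi>Hh \<mu> uc. admissible_order k n \<and> scheme_step \<Omega> \<tau> Cn Pe s m S k n \<phi> \<phi>Hh \<mu> uc \<longrightarrow>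
        L2_inner \<Omega> (\<lambda>x. (bdf_gamma k / \<tau>) * (\<phi> (Suc n) x - \<phi>Hh x)) (\<lambda>x. 1) = 0 \<and>
        (\<forall>\<omega> \<in> S (Suc n).
           L2_inner \<Omega> (\<lambda>x. (bdf_gamma k / \<tau>) *
                (mixture_density \<rho>0 \<rho>\<phi> (\<phi> (Suc n)) x - mixture_density \<rho>0 \<rho>\<phi> \<phi>Hh x)) \<omega>
           - L2_inner \<Omega> (mass_flux \<rho>0 \<rho>\<phi> Pe m k n \<phi> \<mu> uc) (grad \<omega>) = 0))
     \<and>
     (\<forall>\<phi>Hh \<mu> uc n.
        (\<forall>j\<le>n. scheme_step \<Omega> \<tau> Cn Pe s m S (startup_order j) j \<phi> (\<phi>Hh j) (\<mu> j) (uc j)) \<longrightarrow>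
        L2_inner \<Omega> (\<phi> (Suc n)) (\<lambda>x. 1) = L2_inner \<Omega> (\<phi> n) (\<lambda>x. 1) \<and>
        L2_inner \<Omega> (mixture_density \<rho>0 \<rho>\<phi> (\<phi> (Suc n))) (\<lambda>x. 1)
          = L2_inner \<Omega> (mixture_density \<rho>0 \<rho>\<phi> (\<phi> n)) (\<lambda>x. 1))"
proof -
  note meas = polyhedral_domain_lmeasurable[OF domain] polyhedral_domain_sets[OF domain]
  have fe: "v \<in> fe_functions \<Omega> (T l)" if "v \<in> S l" for v l
    using scalar_space that by (auto simp: fe_space_def)
  note eb = fe_function_ess_bounded[OF domain mesh fe]
  have int: "integrable (lebesgue_on \<Omega>) (\<phi> l)" for l
    by (rule ess_bounded_integrable[OF meas(1) eb(1)[OF phase]])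
  have vol: "integrable (lebesgue_on \<Omega>) (\<lambda>x. c)" for c :: real
    by (rule ess_bounded_integrable[OF meas(1) ess_bounded_const])
  note eq = L2_inner_eq[OF meas(2)]
  have mass: "L2_inner \<Omega> f (\<lambda>x. 1) = integral\<^sup>L (lebesgue_on \<Omega>) f" for f :: "real^'n \<Rightarrow> real"
    by (simp add: eq)
  \<comment> \<open>This removes both flux terms from the phase equation and both stiffness terms
    from the Ritz equation when these are tested with 1.\<close>
  have grad_one: "L2_inner \<Omega> f (grad (\<lambda>x. 1)) = 0" for f :: "real^'n \<Rightarrow> real^'n"
    by (simp add: grad_const eq)

  have carrier: "admissible_carrier \<Omega> (S (Suc n)) uc"
    if "admissible_order k n"
      and "topology_changing_carrier \<Omega> (S (Suc n)) (extrapolation k n u) uc \<or> fixed_topology_carrier \<Omega> T S k n u uc"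
    for k n uc
    using that(2)
  proof
    assume "topology_changing_carrier \<Omega> (S (Suc n)) (extrapolation k n u) uc"
    then show ?thesis
      by (rule topology_changing_carrier_admissible[OF domain mesh scalar_space one_in_space
            ess_bounded_extrapolation[OF vector_fe_function_ess_bounded[OF domain mesh vector_space velocity]]])
  next
    assume "fixed_topology_carrier \<Omega> T S k n u uc"
    then show ?thesis
      by (rule fixed_topology_carrier_admissible[OF domain mesh scalar_space one_in_space vector_space velocity that(1)])
  qed

  have increment: "L2_inner \<Omega> (\<lambda>x. (bdf_gamma k / \<tau>) * (\<phi> (Suc n) x - \<phi>Hh x)) (\<lambda>x. 1) = 0"
    if "scheme_step \<Omega> \<tau> Cn Pe s m S k n \<phi> \<phi>Hh \<mu> uc" for k n \<phi>Hh \<mu> uc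
    using that one_in_space[of "Suc n"]
    by (auto simp: scheme_step_def phase_equation_def grad_one dest!: bspec)

  have density: "L2_inner \<Omega> (\<lambda>x. (bdf_gamma k / \<tau>) *
                (mixture_density \<rho>0 \<rho>\<phi> (\<phi> (Suc n)) x - mixture_density \<rho>0 \<rho>\<phi> \<phi>Hh x)) \<omega>
           - L2_inner \<Omega> (mass_flux \<rho>0 \<rho>\<phi> Pe m k n \<phi> \<mu> uc) (grad \<omega>) = 0"
    if step: "scheme_step \<Omega> \<tau> Cn Pe s m S k n \<phi> \<phi>Hh \<mu> uc" and \<omega>: "\<omega> \<in> S (Suc n)" for k n \<phi>Hh \<mu> uc \<omega>
  proof -
    have uc: "uc \<in> L2 \<Omega>" "L2_inner \<Omega> uc (grad \<omega>) = 0" and \<mu>: "\<mu> \<in> S (Suc n)"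
      using step \<omega> by (auto simp: scheme_step_def admissible_carrier_def)
    have E: "ess_bounded \<Omega> (extrapolation k n \<phi>)"
      by (rule ess_bounded_extrapolation[OF eb(1)[OF phase]])
    let ?dt = "L2_inner \<Omega> (\<lambda>x. (bdf_gamma k / \<tau>) * (\<phi> (Suc n) x - \<phi>Hh x)) \<omega>"
      and ?b = "L2_inner \<Omega> (\<lambda>x. extrapolation k n \<phi> x *\<^sub>R uc x) (grad \<omega>)"
      and ?d = "L2_inner \<Omega> (\<lambda>x. m (extrapolation k n \<phi> x) *\<^sub>R grad \<mu> x) (grad \<omega>)"
    have phase_eq: "?dt - ?b + (1 / Pe) * ?d = 0"
      using step \<omega> by (simp add: scheme_step_def phase_equation_def)
    have "((bdf_gamma k / \<tau>) * (mixture_density \<rho>0 \<rho>\<phi> (\<phi> (Suc n)) x - mixture_density \<rho>0 \<rho>\<phi> \<phi>Hh x)) \<bullet> \<omega> x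
        = \<rho>\<phi> * (((bdf_gamma k / \<tau>) * (\<phi> (Suc n) x - \<phi>Hh x)) \<bullet> \<omega> x)" for x
      by (simp add: mixture_density_def algebra_simps)
    then have "L2_inner \<Omega> (\<lambda>x. (bdf_gamma k / \<tau>) *
        (mixture_density \<rho>0 \<rho>\<phi> (\<phi> (Suc n)) x - mixture_density \<rho>0 \<rho>\<phi> \<phi>Hh x)) \<omega> = \<rho>\<phi> * ?dt"
      unfolding eq by (simp only: integral_mult_right_zero)
    \<comment> \<open>The term with factor \<open>\<rho>0\<close> is the carrier constraint tested
      with \<open>\<omega>\<close>, hence zero.\<close>
    moreover have "L2_inner \<Omega> (mass_flux \<rho>0 \<rho>\<phi> Pe m k n \<phi> \<mu> uc) (grad \<omega>) = \<rho>\<phi> * ?b - \<rho>\<phi> / Pe * ?d"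
      using L2_inner_mass_flux[OF meas(1) L2_integrable[OF meas(1) uc(1)] E
          ess_bounded_compose[OF E mobility(2,3)] eb(2)[OF \<mu>] eb(2)[OF \<omega>]] uc(2)
      by simp
    ultimately have "L2_inner \<Omega> (\<lambda>x. (bdf_gamma k / \<tau>) *
          (mixture_density \<rho>0 \<rho>\<phi> (\<phi> (Suc n)) x - mixture_density \<rho>0 \<rho>\<phi> \<phi>Hh x)) \<omega>
        - L2_inner \<Omega> (mass_flux \<rho>0 \<rho>\<phi> Pe m k n \<phi> \<mu> uc) (grad \<omega>) = \<rho>\<phi> * (?dt - ?b + (1 / Pe) * ?d)"
      by (simp add: algebra_simps)
    then show ?thesis
      by (simp only: phase_eq mult_zero_right)
  qed

  have history_mass: "integral\<^sup>L (lebesgue_on \<Omega>) (\<phi> (Suc n)) = integral\<^sup>L (lebesgue_on \<Omega>) (history k n \<phi>)"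
    if step: "scheme_step \<Omega> \<tau> Cn Pe s m S k n \<phi> \<phi>Hh \<mu> uc" for k n \<phi>Hh \<mu> uc
  proof -
    have ritz: "ritz_history \<Omega> Cn s (S (Suc n)) (history k n \<phi>) \<phi>Hh"
      using step by (simp add: scheme_step_def)
    then have H: "integrable (lebesgue_on \<Omega>) \<phi>Hh"
      by (intro ess_bounded_integrable[OF meas(1) eb(1)]) (auto simp: ritz_history_def)
    \<comment> \<open>Only the zero-order terms of the Ritz equation survive; positivity of
      \<open>s\<close> then allows cancelling it.\<close>
    have "s * L2_inner \<Omega> \<phi>Hh (\<lambda>x. 1) = s * L2_inner \<Omega> (history k n \<phi>) (\<lambda>x. 1)"
      using ritz one_in_space[of "Suc n"] by (auto simp: ritz_history_def grad_one dest!: bspec)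
    then have "integral\<^sup>L (lebesgue_on \<Omega>) \<phi>Hh = integral\<^sup>L (lebesgue_on \<Omega>) (history k n \<phi>)"
      using params by (simp add: mass)
    moreover have "bdf_gamma k / \<tau> \<noteq> 0"
      using params by (simp add: bdf_gamma_def)
    then have "integral\<^sup>L (lebesgue_on \<Omega>) (\<phi> (Suc n)) = integral\<^sup>L (lebesgue_on \<Omega>) \<phi>Hh"
      using increment[OF step] int[of "Suc n"] H
      unfolding mass integral_mult_right_zero by simp
    ultimately show ?thesis by simp
  qed

  have conserved: "integral\<^sup>L (lebesgue_on \<Omega>) (\<phi> (Suc n)) = integral\<^sup>L (lebesgue_on \<Omega>) (\<phi> n)"
    if "\<forall>j\<le>n. scheme_step \<Omega> \<tau> Cn Pe s m S (startup_order j) j \<phi> (\<phi>Hh j) (\<mu> j) (uc j)" for \<phi>Hh \<mu> uc n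
    using that
  proof (induction n)
    case 0
    then show ?case
      using history_mass[OF 0[rule_format, OF order_refl]] by (simp add: startup_order_def history_def[abs_def])
  next
    case (Suc n)
    \<comment> \<open>From the second step on the order is 2, and the history at
      \<open>Suc n\<close> combines the levels \<open>Suc n\<close> and \<open>n\<close>. Their
      masses agree by the induction hypothesis, and the weights 4/3 and -1/3 sum to 1.\<close>
    have "integral\<^sup>L (lebesgue_on \<Omega>) (\<phi> (Suc (Suc n))) = integral\<^sup>L (lebesgue_on \<Omega>) (history 2 (Suc n) \<phi>)"
      using history_mass[OF Suc.prems[rule_format, OF order_refl]] by (simp add: startup_order_def)
    also have "\<dots> = (1/3) * (4 * integral\<^sup>L (lebesgue_on \<Omega>) (\<phi> (Suc n)) - integral\<^sup>L (lebesgue_on \<Omega>) (\<phi> n))"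
      using int by (simp add: history_def[abs_def])
    also have "\<dots> = integral\<^sup>L (lebesgue_on \<Omega>) (\<phi> (Suc n))"
      using Suc by simp
    finally show ?case .
  qed
  have density_mass: "L2_inner \<Omega> (mixture_density \<rho>0 \<rho>\<phi> (\<phi> l)) (\<lambda>x. 1) =
      integral\<^sup>L (lebesgue_on \<Omega>) (\<lambda>x. \<rho>0) + \<rho>\<phi> * integral\<^sup>L (lebesgue_on \<Omega>) (\<phi> l)" for l
    using int[of l] vol[of \<rho>0] by (simp add: mass mixture_density_def[abs_def])
  show ?thesis
    by (intro conjI allI impI ballI; (elim conjE)?)
       (rule carrier increment density; assumption
        | simp only: density_mass conserved | simp only: mass conserved)+
qed

end
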